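(* There exist an ergodic dynamical system $(\Omega,\mathcal A,\mu,T)$, an increasing filtration $(\mathcal F_i)_{i\in\mathbb Z}$ of sub-$\sigma$-algebras of $\mathcal A$ with $T^{-1}\mathcal F_i=\mathcal F_{i+1}$ for all $i$, and a square integrable, zero mean, $\mathcal F_0$-measurable function $f$ on $\Omega$ such that $$\|E(S_n(f)\mid\mathcal F_0)\|_2=o\Big(\frac{\sqrt n}{\log n}\Big)\qquad (n\to\infty),$$ but there are two subsequences $(n_k')$ and $(n_k'')$ of the positive integers along which the distributions of $S_{n_k'}(f)/\sigma_{n_k'}$ and of $S_{n_k''}(f)/\sigma_{n_k''}$ converge weakly to two different limits.
   Context: A dynamical system $(\Omega,\mathcal A,\mu,T)$ is a probability space $(\Omega,\mathcal A,\mu)$ with a bijective, bimeasurable, measure preserving map $T:\Omega\to\Omega$; it is ergodic if $A=T^{-1}A$, $A\in\mathcal A$, implies $\mu(A)\in\{0,1\}$. For a function $f$ on $\Omega$, $S_n(f)=\sum_{i=0}^{n-1} f\circ T^i$ and $\sigma_n=\|S_n(f)\|_2$ (norm in $L^2(\mu)$). *)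

theory Defs
  imports "HOL-Probability.Probability" "HOL-Library.Landau_Symbols"
begin

locale dynamical_system = prob_space M for M :: "'a measure" +
  fixes T :: "'a \<Rightarrow> 'a"
  assumes T_bij: "bij_betw T (space M) (space M)"
    and T_measurable: "T \<in> measurable M M"
    and T_inv_measurable: "the_inv_into (space M) T \<in> measurable M M"
    and T_preserving: "distr M M T = M"

locale ergodic_dynamical_system = dynamical_system +
  assumes ergodic:
    "\<And>A. A \<in> sets M \<Longrightarrow> A = T -` A \<inter> space M \<Longrightarrow> measure M A \<in> {0, 1}"

definition birkhoff_sum :: "('a \<Rightarrow> 'a) \<Rightarrow> ('a \<Rightarrow> real) \<Rightarrow> nat \<Rightarrow> 'a \<Rightarrow> real" where
  "birkhoff_sum T f n x = (\<Sum>i<n. f ((T ^^ i) x))"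

text \<open>The Bochner integral is \<open>0\<close> for non-integrable functions, so this is the
  norm of \<open>L\<^sup>2(M)\<close> only for square integrable \<open>g\<close>.\<close>

definition l2_norm :: "'a measure \<Rightarrow> ('a \<Rightarrow> real) \<Rightarrow> real" where
  "l2_norm M g = sqrt (\<integral>x. (g x)\<^sup>2 \<partial>M)"

text \<open>Weak convergence, along the subsequence \<open>m\<close>, of the distributions of the sums
  normalised by their \<open>L\<^sup>2\<close> norms. The norms are required to be positive along
  the subsequence, since division by zero would otherwise yield the value \<open>0\<close>.\<close>

definition normalized_sums_converge ::
    "'a measure \<Rightarrow> ('a \<Rightarrow> 'a) \<Rightarrow> ('a \<Rightarrow> real) \<Rightarrow> (nat \<Rightarrow> nat) \<Rightarrow> real measure \<Rightarrow> bool" where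
  "normalized_sums_converge M T f m \<nu> \<longleftrightarrow>
     (\<forall>k. l2_norm M (birkhoff_sum T f (m k)) > 0) \<and>
     weak_conv_m
       (\<lambda>k. distr M borel
          (\<lambda>x. birkhoff_sum T f (m k) x / l2_norm M (birkhoff_sum T f (m k)))) \<nu>"

text \<open>HOL cannot quantify existentially over types, so a carrier type for the state space
  has to be fixed; \<open>space M\<close> may be any subset of it. The type below is the path
  space of two-sided processes with values in real sequences.\<close>

type_synonym path = "int \<Rightarrow> nat \<Rightarrow> real"

end

theory Submission
  imports Defs "HOL-Real_Asymp.Real_Asymp"
begin

text \<open>
  The process is a superposition \<open>f = \<Sum>m. f m\<close> of one-sided moving averages
  \<open>f m = \<Sum>i. a m i * \<xi>(-i, m)\<close>, where for each \<open>m\<close> the innovations \<open>\<xi>(i, m)\<close> are i.i.d.,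
  centred and of variance 1. The coefficients \<open>a m i\<close> are a tiny multiple of
  \<open>1 / ((i + 1) (1 + ln (i + 1)))\<close>, cut off once their sum reaches \<open>m * m!\<close>. Because this series
  diverges, the cut-off exists, so the \<open>m\<close>-th sums eventually have variance about \<open>(m * m!)\<^sup>2 n\<close>;
  because the coefficients decay slowly, the part of the sum predictable from the past has norm at
  most \<open>e m * sqrt n / (1 + ln n)\<close> for every \<open>n\<close>, with \<open>\<Sum>m. e m < \<infinity>\<close>.

  Along a rapidly growing sequence \<open>n m\<close> the \<open>m\<close>-th component dominates all the others. For even
  \<open>m\<close> its innovations are standard normal, which gives the limit \<open>N(0, 1)\<close>. For odd \<open>m\<close> they vanish
  except on an event so rare that the first \<open>n m\<close> sums do not see it, which gives the limit \<open>\<delta>\<^sub>0\<close>.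
\<close>

section \<open>Slowly decaying coefficients\<close>

text \<open>The logarithm marks the edge of the Maxwell-Woodroofe criterion, which gives a central
  limit theorem once the sum of n^(-3/2) ||E(S_n | F_0)||_2 over n is finite: at the rate sqrt n /
  ln n this becomes the sum of 1 / (n ln n), which just diverges, and the same divergence leaves
  room for arbitrarily large coefficient sums. Two quantities compete: the long-run variance is the
  square of the coefficient sum, while the predictable part sees only sums over windows, in l2. The
  totals m * m! come from k * k! = (k+1)! - k!: all earlier totals add up to m! - 1, a factor of
  more than m below the m-th. Later components are not yet felt at time n m because their e k are
  chosen after n m. The norms use only mean 0 and variance 1 of the independent innovations, so the
  laws remain free and can be fixed last, once n m is known; a rare innovation keeps its variance,
  hence the dominance in L2, although the normalised sum of its component is 0 with probability
  close to 1.\<close>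

lemma dual_hardy:
  fixes a :: "nat \<Rightarrow> real"
  shows "(\<Sum>i<L. (\<Sum>l=i..<L. a l)\<^sup>2) \<le> 4 * (\<Sum>l<L. (real (Suc l) * a l)\<^sup>2)"
proof -
  define R where "R i = (\<Sum>l=i..<L. a l)" for i
  \<comment> \<open>Summation by parts; the boundary term drops out at k = L, where
    \<open>R L\<close> is an empty sum. The result is the discrete dual Hardy inequality with its
    classical constant 4.\<close>
  have parts: "(\<Sum>i<k. (R i)\<^sup>2) = (\<Sum>l<k. real (Suc l) * ((R l)\<^sup>2 - (R (Suc l))\<^sup>2)) + real k * (R k)\<^sup>2" for k
    by (induction k) (auto simp: algebra_simps)
  have "(\<Sum>i<L. (R i)\<^sup>2) = (\<Sum>l<L. real (Suc l) * ((R l)\<^sup>2 - (R (Suc l))\<^sup>2))"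
    using parts[of L] by (simp add: R_def)
  also have "\<dots> \<le> (\<Sum>l<L. (R l)\<^sup>2 / 2 + 2 * (real (Suc l) * a l)\<^sup>2)"
  proof (rule sum_mono)
    fix l assume "l \<in> {..<L}"
    then have R: "R (Suc l) = R l - a l"
      by (simp add: R_def sum.atLeast_Suc_lessThan)
    define q where "q = real (Suc l) * a l"
    \<comment> \<open>The weights in Young's inequality leave the factor 1/2 at
      \<open>(R l)\<^sup>2\<close>, which is absorbed on the left: X \<le> X/2 + 2Y gives X \<le>
      4Y.\<close>
    have "0 \<le> (R l - 2 * q)\<^sup>2" by simp
    then have "2 * (q * R l) \<le> (R l)\<^sup>2 / 2 + 2 * q\<^sup>2"
      by (simp add: power2_eq_square algebra_simps)
    moreover have "real (Suc l) * ((R l)\<^sup>2 - (R (Suc l))\<^sup>2) = 2 * (q * R l) - real (Suc l) * (a l)\<^sup>2"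
      unfolding R q_def by (simp add: power2_eq_square algebra_simps)
    moreover have "0 \<le> real (Suc l) * (a l)\<^sup>2" by simp
    ultimately show "real (Suc l) * ((R l)\<^sup>2 - (R (Suc l))\<^sup>2) \<le> (R l)\<^sup>2 / 2 + 2 * (real (Suc l) * a l)\<^sup>2"
      unfolding q_def by linarith
  qed
  also have "\<dots> = (\<Sum>i<L. (R i)\<^sup>2) / 2 + 2 * (\<Sum>l<L. (real (Suc l) * a l)\<^sup>2)"
    by (simp add: sum.distrib sum_distrib_left sum_divide_distrib)
  finally show ?thesis by (simp add: R_def)
qed

lemma one_plus_ln_le_root4:
  assumes "z \<ge> (1::real)"
  shows "1 + ln z \<le> 4 * sqrt (sqrt z)"
proof -
  define s where "s = sqrt (sqrt z)"
  have "s\<^sup>2 = sqrt z" using assms by (simp add: s_def)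
  then have "(s\<^sup>2)\<^sup>2 = z" using assms by simp
  then have z: "z = s ^ 4" by (simp flip: power_mult)
  have s: "s \<ge> 1" using assms by (simp add: s_def)
  have "ln z = 4 * ln s" using s z by (simp add: ln_realpow)
  with ln_le_minus_one[of s] s show ?thesis by (simp add: s_def)
qed

text \<open>Slow variation of the logarithm as a Potter-type bound: 1 + ln y is at most (1 + ln x)
  (1 + ln (y/x)), and the second factor is absorbed by a fourth root. After squaring, the exponent
  of y/x is 1/2, still below 1, so that summing over x up to y will give order y.\<close>

lemma one_plus_ln_ratio:
  fixes x y :: real
  assumes "1 \<le> x" "x \<le> y"
  shows "1 / (1 + ln x)\<^sup>2 \<le> 16 * sqrt (y / x) / (1 + ln y)\<^sup>2"
proof -
  have z: "y / x \<ge> 1" using assms by simp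
  have "1 + ln y = 1 + ln x + ln (y / x)" using assms by (simp add: ln_div)
  also have "\<dots> \<le> (1 + ln x) * (1 + ln (y / x))"
    using assms z by (simp add: algebra_simps)
  also have "\<dots> \<le> (1 + ln x) * (4 * sqrt (sqrt (y / x)))"
    using assms one_plus_ln_le_root4[OF z] by (intro mult_left_mono) auto
  finally have "(1 + ln y)\<^sup>2 \<le> ((1 + ln x) * (4 * sqrt (sqrt (y / x))))\<^sup>2"
    using assms by (intro power_mono) auto
  also have "\<dots> = (1 + ln x)\<^sup>2 * (16 * sqrt (y / x))"
    using z by (simp add: power_mult_distrib)
  finally have *: "(1 + ln y)\<^sup>2 \<le> (1 + ln x)\<^sup>2 * (16 * sqrt (y / x))" .
  have "0 < 1 + ln x" "0 < 1 + ln y" using assms by (auto simp: add_pos_nonneg)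
  then show ?thesis using * by (simp add: field_simps)
qed

lemma sum_inverse_sqrt_le: "(\<Sum>l<L. 1 / sqrt (real (Suc l))) \<le> 2 * sqrt (real L)"
proof (induction L)
  case (Suc L)
  have "1 / sqrt (real (Suc L)) \<le> 2 * (sqrt (real (Suc L)) - sqrt (real L))"
  proof -
    have "(sqrt (real (Suc L)) - sqrt (real L)) * (sqrt (real (Suc L)) + sqrt (real L)) = 1"
      by (simp add: algebra_simps)
    moreover have "(sqrt (real (Suc L)) - sqrt (real L)) * (sqrt (real (Suc L)) + sqrt (real L))
        \<le> (sqrt (real (Suc L)) - sqrt (real L)) * (2 * sqrt (real (Suc L)))"
      by (intro mult_left_mono) auto
    ultimately show ?thesis by (simp add: field_simps)
  qed
  with Suc.IH show ?case by simp
qed simp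

text \<open>Each term is compared with the value at L at the cost of 16 sqrt (L / (l+1)), and these
  square roots add up to at most 2 L; up to a constant the logarithm behaves as if it were frozen at
  L.\<close>

lemma sum_inverse_ln_squared_le:
  assumes "L \<ge> 1"
  shows "(\<Sum>l<L. 1 / (1 + ln (real (Suc l)))\<^sup>2) \<le> 32 * real L / (1 + ln (real L))\<^sup>2"
proof -
  have "(\<Sum>l<L. 1 / (1 + ln (real (Suc l)))\<^sup>2)
      \<le> (\<Sum>l<L. 16 * sqrt (real L) / (1 + ln (real L))\<^sup>2 * (1 / sqrt (real (Suc l))))"
  proof (rule sum_mono)
    fix l assume "l \<in> {..<L}"
    then have "1 \<le> real (Suc l)" "real (Suc l) \<le> real L" by auto
    from one_plus_ln_ratio[OF this]
    show "1 / (1 + ln (real (Suc l)))\<^sup>2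
        \<le> 16 * sqrt (real L) / (1 + ln (real L))\<^sup>2 * (1 / sqrt (real (Suc l)))"
      by (simp add: real_sqrt_divide mult.commute)
  qed
  also have "\<dots> = 16 * sqrt (real L) / (1 + ln (real L))\<^sup>2 * (\<Sum>l<L. 1 / sqrt (real (Suc l)))"
    by (simp add: sum_distrib_left)
  also have "\<dots> \<le> 16 * sqrt (real L) / (1 + ln (real L))\<^sup>2 * (2 * sqrt (real L))"
    by (intro mult_left_mono sum_inverse_sqrt_le) auto
  finally show ?thesis by simp
qed

lemma sum_inverse_squares_tail_le:
  assumes "n \<ge> 1"
  shows "(\<Sum>i=n..<n+K. 1 / (real (Suc i))\<^sup>2) \<le> 1 / real n"
proof -
  have "(\<Sum>i=n..<n+K. 1 / (real (Suc i))\<^sup>2) \<le> 1 / real n - 1 / real (n + K)"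
  proof (induction K)
    case (Suc K)
    define y where "y = real (n + K)"
    have "y > 0" using assms by (simp add: y_def)
    then have "1 / (y + 1)\<^sup>2 \<le> 1 / y - 1 / (y + 1)"
      by (simp add: divide_simps power2_eq_square)
    then have "1 / (real (Suc (n + K)))\<^sup>2 \<le> 1 / real (n + K) - 1 / real (Suc (n + K))"
      by (simp add: y_def add_ac)
    with Suc.IH show ?case by simp
  qed simp
  moreover have "0 \<le> 1 / real (n + K)" by simp
  ultimately show ?thesis by linarith
qed

text \<open>Windows are split by their starting point. Those starting before n are prolonged to the
  common end 2n, where the Hardy inequality applies. One starting at i \<ge> n has n terms of size
  at most \<open>\<theta> / ((i+1) (1 + ln n))\<close>, and the squares of 1 / (i+1) have a tail of
  at most 1/n.\<close>

lemma window_sums_le: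
  fixes a :: "nat \<Rightarrow> real"
  assumes a0: "\<And>l. 0 \<le> a l" and a1: "\<And>l. a l \<le> \<theta> / (real (Suc l) * (1 + ln (real (Suc l))))"
    and "\<theta> \<ge> 0" and n: "n \<ge> 1"
  shows "(\<Sum>i<K. (\<Sum>l=i..<i+n. a l)\<^sup>2) \<le> (17 * \<theta>)\<^sup>2 * real n / (1 + ln (real n))\<^sup>2"
proof -
  have pos: "0 < 1 + ln (real (Suc l))" for l by (simp add: add_pos_nonneg)
  have posn: "0 < 1 + ln (real n)" using n by (simp add: add_pos_nonneg)
  have "(\<Sum>i<K. (\<Sum>l=i..<i+n. a l)\<^sup>2) \<le> (\<Sum>i\<in>{..<n} \<union> {n..<n+K}. (\<Sum>l=i..<i+n. a l)\<^sup>2)"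
    by (intro sum_mono2) auto
  also have "\<dots> = (\<Sum>i<n. (\<Sum>l=i..<i+n. a l)\<^sup>2) + (\<Sum>i=n..<n+K. (\<Sum>l=i..<i+n. a l)\<^sup>2)"
    by (intro sum.union_disjoint) auto
  also have "(\<Sum>i<n. (\<Sum>l=i..<i+n. a l)\<^sup>2) \<le> (\<Sum>i<n. (\<Sum>l=i..<2*n. a l)\<^sup>2)"
    using a0 by (intro sum_mono power_mono sum_mono2 sum_nonneg) auto
  also have "\<dots> \<le> (\<Sum>i<2*n. (\<Sum>l=i..<2*n. a l)\<^sup>2)"
    by (intro sum_mono2) auto
  also have "\<dots> \<le> 4 * (\<Sum>l<2*n. (real (Suc l) * a l)\<^sup>2)" by (rule dual_hardy)
  also have "\<dots> \<le> 4 * (\<Sum>l<2*n. \<theta>\<^sup>2 * (1 / (1 + ln (real (Suc l)))\<^sup>2))"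
  proof (intro mult_left_mono sum_mono)
    fix l
    have "real (Suc l) * a l \<le> \<theta> / (1 + ln (real (Suc l)))"
      using mult_left_mono[OF a1[of l], of "real (Suc l)"] by simp
    then have "(real (Suc l) * a l)\<^sup>2 \<le> (\<theta> / (1 + ln (real (Suc l))))\<^sup>2"
      using a0[of l] by (intro power_mono) auto
    then show "(real (Suc l) * a l)\<^sup>2 \<le> \<theta>\<^sup>2 * (1 / (1 + ln (real (Suc l)))\<^sup>2)"
      by (simp add: power_divide)
  qed simp
  also have "\<dots> = 4 * \<theta>\<^sup>2 * (\<Sum>l<2*n. 1 / (1 + ln (real (Suc l)))\<^sup>2)"
    by (simp add: sum_distrib_left)
  also have "\<dots> \<le> 4 * \<theta>\<^sup>2 * (32 * real (2 * n) / (1 + ln (real (2 * n)))\<^sup>2)"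
    using n by (intro mult_left_mono sum_inverse_ln_squared_le) auto
  also have "\<dots> \<le> 4 * \<theta>\<^sup>2 * (32 * real (2 * n) / (1 + ln (real n))\<^sup>2)"
  proof -
    have "0 < 1 + ln (real (2 * n))" using n by (intro add_pos_nonneg) auto
    then show ?thesis
      using n posn by (intro mult_left_mono divide_left_mono power_mono mult_pos_pos zero_less_power) auto
  qed
  also have "(\<Sum>i=n..<n+K. (\<Sum>l=i..<i+n. a l)\<^sup>2)
      \<le> (\<Sum>i=n..<n+K. (real n * \<theta> / (1 + ln (real n)))\<^sup>2 * (1 / (real (Suc i))\<^sup>2))"
  proof (rule sum_mono)
    fix i assume i: "i \<in> {n..<n+K}"
    have "(\<Sum>l=i..<i+n. a l) \<le> (\<Sum>l=i..<i+n. \<theta> / (real (Suc i) * (1 + ln (real n))))"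
    proof (rule sum_mono)
      fix l assume "l \<in> {i..<i+n}"
      then have "\<theta> / (real (Suc l) * (1 + ln (real (Suc l)))) \<le> \<theta> / (real (Suc i) * (1 + ln (real n)))"
        using i n \<open>\<theta> \<ge> 0\<close> posn pos[of l]
        by (intro divide_left_mono mult_mono mult_pos_pos) auto
      then show "a l \<le> \<theta> / (real (Suc i) * (1 + ln (real n)))" using a1[of l] by linarith
    qed
    also have "\<dots> = real n * \<theta> / (1 + ln (real n)) * (1 / real (Suc i))" by simp
    finally have "(\<Sum>l=i..<i+n. a l)\<^sup>2 \<le> (real n * \<theta> / (1 + ln (real n)) * (1 / real (Suc i)))\<^sup>2"
      using a0 by (intro power_mono sum_nonneg) auto
    then show "(\<Sum>l=i..<i+n. a l)\<^sup>2 \<le> (real n * \<theta> / (1 + ln (real n)))\<^sup>2 * (1 / (real (Suc i))\<^sup>2)"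
      by (simp add: power_divide power_mult_distrib)
  qed
  also have "\<dots> = (real n * \<theta> / (1 + ln (real n)))\<^sup>2 * (\<Sum>i=n..<n+K. 1 / (real (Suc i))\<^sup>2)"
    by (simp add: sum_distrib_left)
  also have "\<dots> \<le> (real n * \<theta> / (1 + ln (real n)))\<^sup>2 * (1 / real n)"
    by (intro mult_left_mono sum_inverse_squares_tail_le n) auto
  finally have "(\<Sum>i<K. (\<Sum>l=i..<i+n. a l)\<^sup>2) \<le> 4 * \<theta>\<^sup>2 * (32 * real (2 * n) / (1 + ln (real n))\<^sup>2)
      + (real n * \<theta> / (1 + ln (real n)))\<^sup>2 * (1 / real n)" by simp
  also have "\<dots> = 257 * (\<theta>\<^sup>2 * real n / (1 + ln (real n))\<^sup>2)"
    using n by (simp add: power_divide power_mult_distrib power2_eq_square)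
  \<comment> \<open>The constant 257 = 4 * 32 * 2 + 1 is rounded up to 289 = 17^2, so that the bound
    is a square.\<close>
  also have "\<dots> \<le> 289 * (\<theta>\<^sup>2 * real n / (1 + ln (real n))\<^sup>2)"
    by (intro mult_right_mono) auto
  finally show ?thesis by (simp add: power_mult_distrib)
qed

text \<open>\<open>ln (1 + ln x)\<close> is an antiderivative of 1 / (x (1 + ln x)); the integral
  comparison is made increment by increment with ln (1 + t) \<le> t, once for each
  logarithm.\<close>

lemma sum_inverse_log_ge:
  "ln (1 + ln (real (Suc L))) \<le> (\<Sum>l<L. 1 / (real (Suc l) * (1 + ln (real (Suc l)))))"
proof (induction L)
  case (Suc L)
  define u where "u = 1 + ln (real (Suc L))"
  have u: "u \<ge> 1" by (simp add: u_def)
  have "ln (1 + ln (real (Suc (Suc L)))) \<le> ln (u + 1 / real (Suc L))"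
  proof -
    have "ln (real (Suc (Suc L))) - ln (real (Suc L)) = ln (1 + 1 / real (Suc L))"
    proof -
      have "1 + 1 / real (Suc L) = real (Suc (Suc L)) / real (Suc L)" by (simp add: field_simps)
      then show ?thesis by (simp add: ln_div)
    qed
    also have "\<dots> \<le> 1 / real (Suc L)" by (rule ln_add_one_self_le_self) simp
    finally show ?thesis by (simp add: u_def add_pos_nonneg)
  qed
  also have "\<dots> = ln u + ln (1 + 1 / (real (Suc L) * u))"
  proof -
    have "u + 1 / real (Suc L) = u * (1 + 1 / (real (Suc L) * u))"
      using u by (simp add: distrib_left)
    then show ?thesis using u by (simp only:) (rule ln_mult_pos, auto simp: add_pos_nonneg)
  qed
  also have "\<dots> \<le> ln u + 1 / (real (Suc L) * u)"
    using u by (intro add_left_mono ln_add_one_self_le_self) auto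
  finally show ?case using Suc.IH by (simp add: u_def)
qed simp

text \<open>The sum c and the bound \<epsilon> can be prescribed independently: divergence allows a
  cut-off so late that the normalising factor c / B falls below \<theta>, and the window estimate
  does not depend on the cut-off.\<close>

lemma ex_slow_coefficients:
  fixes c \<epsilon> :: real
  assumes "c \<ge> 0" "\<epsilon> > 0"
  shows "\<exists>a N. (\<forall>i. 0 \<le> a i) \<and> (\<forall>i\<ge>N. a i = 0) \<and> (\<Sum>i<N. a i) = c \<and>
    (\<forall>n\<ge>1. \<forall>K. (\<Sum>i<K. (\<Sum>l=i..<i+n. a l)\<^sup>2) \<le> \<epsilon>\<^sup>2 * real n / (1 + ln (real n))\<^sup>2)"
proof -
  define b where "b l = 1 / (real (Suc l) * (1 + ln (real (Suc l))))" for l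
  have b0: "0 < b l" for l by (simp add: b_def add_pos_nonneg)
  \<comment> \<open>The divisor cancels the 17 of the window estimate.\<close>
  define \<theta> where "\<theta> = \<epsilon> / 17"
  have \<theta>: "\<theta> > 0" using assms by (simp add: \<theta>_def)
  have "filterlim (\<lambda>L. ln (1 + ln (real (Suc L)))) at_top sequentially"
    by real_asymp
  \<comment> \<open>The extra 1 keeps the partial sum positive when c = 0, which is the case of
    component 0.\<close>
  then have "eventually (\<lambda>L. c / \<theta> + 1 \<le> ln (1 + ln (real (Suc L)))) sequentially"
    by (simp add: filterlim_at_top)
  then obtain N where "c / \<theta> + 1 \<le> ln (1 + ln (real (Suc N)))"
    unfolding eventually_sequentially by blast
  also have "\<dots> \<le> (\<Sum>l<N. b l)" unfolding b_def by (rule sum_inverse_log_ge)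
  finally have N: "c / \<theta> + 1 \<le> (\<Sum>l<N. b l)" .
  define B where "B = (\<Sum>l<N. b l)"
  have "0 \<le> c / \<theta>" using assms \<theta> by simp
  then have B0: "B > 0"
    using N unfolding B_def by linarith
  moreover have "c \<le> B * \<theta>"
  proof -
    have "c = c / \<theta> * \<theta>" using \<theta> by simp
    also have "\<dots> \<le> B * \<theta>" using N \<theta> by (intro mult_right_mono) (auto simp: B_def)
    finally show ?thesis .
  qed
  ultimately have B: "B > 0" "c / B \<le> \<theta>"
    by (simp_all add: divide_le_eq mult.commute)
  define a where "a l = (if l < N then c / B * b l else 0)" for l
  have "0 \<le> a i" for i
    using assms B b0[of i] by (simp add: a_def)
  moreover have "a l \<le> \<theta> / (real (Suc l) * (1 + ln (real (Suc l))))" for l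
  proof -
    have "a l \<le> \<theta> * b l"
      using B \<theta> b0[of l] by (auto simp: a_def intro!: mult_right_mono simp del: times_divide_eq_left)
    then show ?thesis by (simp add: b_def)
  qed
  ultimately have "(\<Sum>i<K. (\<Sum>l=i..<i+n. a l)\<^sup>2) \<le> \<epsilon>\<^sup>2 * real n / (1 + ln (real n))\<^sup>2"
    if "n \<ge> 1" for n K
    using window_sums_le[of a \<theta> n K] that \<theta> by (simp add: \<theta>_def)
  moreover have "(\<Sum>i<N. a i) = c"
  proof -
    have "(\<Sum>i<N. a i) = c / B * B"
      unfolding B_def sum_distrib_left by (intro sum.cong) (auto simp: a_def B_def)
    then show ?thesis using B by simp
  qed
  moreover have "\<forall>i\<ge>N. a i = 0" by (simp add: a_def)
  ultimately show ?thesis using \<open>\<And>i. 0 \<le> a i\<close> by blast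
qed

section \<open>Square integrable functions\<close>

definition square_integrable :: "'a measure \<Rightarrow> ('a \<Rightarrow> real) \<Rightarrow> bool" where
  "square_integrable M g \<longleftrightarrow> g \<in> borel_measurable M \<and> integrable M (\<lambda>x. (g x)\<^sup>2)"

lemma l2_norm_nonneg: "0 \<le> l2_norm M g"
  by (simp add: l2_norm_def)

lemma l2_norm_power2: "(l2_norm M g)\<^sup>2 = (\<integral>x. (g x)\<^sup>2 \<partial>M)"
  by (simp add: l2_norm_def)

lemma l2_norm_cong_AE:
  assumes "g \<in> borel_measurable M" "h \<in> borel_measurable M" "AE x in M. g x = h x"
  shows "l2_norm M g = l2_norm M h"
  unfolding l2_norm_def using assms by (intro arg_cong[where f = sqrt] integral_cong_AE) auto

lemma square_integrable_cong_AE: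
  assumes "square_integrable M g" "h \<in> borel_measurable M" "AE x in M. g x = h x"
  shows "square_integrable M h"
proof -
  have "integrable M (\<lambda>x. (g x)\<^sup>2) = integrable M (\<lambda>x. (h x)\<^sup>2)"
    using assms by (intro integrable_cong_AE) (auto simp: square_integrable_def)
  then show ?thesis using assms by (simp add: square_integrable_def)
qed

text \<open>Minkowski's inequality through Young's inequality with free weights a and b: if they
  equal the two norms, the integrated bound is exactly (a + b)^2.\<close>

lemma
  assumes "square_integrable M g" "square_integrable M h"
  shows square_integrable_add: "square_integrable M (\<lambda>x. g x + h x)"
    and l2_norm_triangle: "l2_norm M (\<lambda>x. g x + h x) \<le> l2_norm M g + l2_norm M h"
proof -
  have [measurable]: "g \<in> borel_measurable M" "h \<in> borel_measurable M"
    and int[simp]: "integrable M (\<lambda>x. (g x)\<^sup>2)" "integrable M (\<lambda>x. (h x)\<^sup>2)"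
    using assms by (auto simp: square_integrable_def)
  have pw: "(g x + h x)\<^sup>2 \<le> (1 + b / a) * (g x)\<^sup>2 + (1 + a / b) * (h x)\<^sup>2" if "a > 0" "b > 0" for a b x
  proof -
    have "0 \<le> (sqrt (b / a) * g x - sqrt (a / b) * h x)\<^sup>2" by simp
    also have "\<dots> = b / a * (g x)\<^sup>2 + a / b * (h x)\<^sup>2 - 2 * (sqrt (b / a) * sqrt (a / b)) * g x * h x"
      using that by (simp add: power2_diff power_mult_distrib)
    also have "sqrt (b / a) * sqrt (a / b) = 1" using that by (simp flip: real_sqrt_mult)
    finally show ?thesis by (simp add: power2_sum algebra_simps)
  qed
  have int2: "integrable M (\<lambda>x. (g x + h x)\<^sup>2)"
    by (rule Bochner_Integration.integrable_bound[where f = "\<lambda>x. 2 * (g x)\<^sup>2 + 2 * (h x)\<^sup>2"])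
       (use pw[of 1 1] in auto)
  then show "square_integrable M (\<lambda>x. g x + h x)" by (simp add: square_integrable_def)
  show "l2_norm M (\<lambda>x. g x + h x) \<le> l2_norm M g + l2_norm M h"
  proof (rule field_le_epsilon)
    fix e :: real assume "e > 0"
    \<comment> \<open>The added e / 2 keeps both weights positive even if a norm vanishes.\<close>
    define a where "a = l2_norm M g + e / 2"
    define b where "b = l2_norm M h + e / 2"
    have ab: "a > 0" "b > 0" using \<open>e > 0\<close> by (auto simp: a_def b_def add_nonneg_pos l2_norm_nonneg)
    have "(\<integral>x. (g x + h x)\<^sup>2 \<partial>M) \<le> (\<integral>x. (1 + b / a) * (g x)\<^sup>2 + (1 + a / b) * (h x)\<^sup>2 \<partial>M)"
      by (intro integral_mono int2 pw ab Bochner_Integration.integrable_add integrable_mult_right int)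
    also have "\<dots> = (1 + b / a) * (l2_norm M g)\<^sup>2 + (1 + a / b) * (l2_norm M h)\<^sup>2"
      by (simp add: l2_norm_power2)
    also have "\<dots> \<le> (1 + b / a) * a\<^sup>2 + (1 + a / b) * b\<^sup>2"
      using ab \<open>e > 0\<close>
      by (intro add_mono mult_left_mono power_mono) (auto simp: a_def b_def l2_norm_nonneg)
    also have "\<dots> = (a + b)\<^sup>2"
      using ab by (simp add: power2_eq_square field_simps)
    finally have "l2_norm M (\<lambda>x. g x + h x) \<le> a + b"
      unfolding l2_norm_def using ab by (intro real_le_lsqrt) auto
    then show "l2_norm M (\<lambda>x. g x + h x) \<le> l2_norm M g + l2_norm M h + e"
      by (simp add: a_def b_def)
  qed
qed

lemma square_integrable_cmult: "square_integrable M g \<Longrightarrow> square_integrable M (\<lambda>x. c * g x)"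
  unfolding square_integrable_def power_mult_distrib
  by (auto intro!: borel_measurable_times integrable_mult_right)

lemma l2_norm_cmult: "l2_norm M (\<lambda>x. c * g x) = \<bar>c\<bar> * l2_norm M g"
  by (simp add: l2_norm_def power_mult_distrib real_sqrt_mult)

lemma
  assumes "\<And>i. i \<in> I \<Longrightarrow> square_integrable M (h i)"
  shows square_integrable_sum: "square_integrable M (\<lambda>x. \<Sum>i\<in>I. h i x)"
    and l2_norm_sum: "l2_norm M (\<lambda>x. \<Sum>i\<in>I. h i x) \<le> (\<Sum>i\<in>I. l2_norm M (h i))"
proof -
  have "square_integrable M (\<lambda>x. \<Sum>i\<in>I. h i x) \<and>
      l2_norm M (\<lambda>x. \<Sum>i\<in>I. h i x) \<le> (\<Sum>i\<in>I. l2_norm M (h i))"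
    using assms
  proof (induction I rule: infinite_finite_induct)
    case (insert i I)
    then show ?case
      using square_integrable_add[of M "h i" "\<lambda>x. \<Sum>i\<in>I. h i x"]
        l2_norm_triangle[of M "h i" "\<lambda>x. \<Sum>i\<in>I. h i x"] by auto
  qed (auto simp: square_integrable_def l2_norm_def)
  then show "square_integrable M (\<lambda>x. \<Sum>i\<in>I. h i x)"
    and "l2_norm M (\<lambda>x. \<Sum>i\<in>I. h i x) \<le> (\<Sum>i\<in>I. l2_norm M (h i))" by auto
qed

section \<open>Series in L2 and convergence in law on a probability space\<close>

context prob_space
begin

lemma
  assumes "square_integrable M g"
  shows integrable_of_square_integrable: "integrable M g"
    and l1_le_l2_norm: "(\<integral>x. \<bar>g x\<bar> \<partial>M) \<le> l2_norm M g"
proof -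
  have [measurable]: "g \<in> borel_measurable M" and sq[simp]: "integrable M (\<lambda>x. (g x)\<^sup>2)"
    using assms by (auto simp: square_integrable_def)
  show int: "integrable M g" by (rule square_integrable_imp_integrable) auto
  have "(\<integral>x. \<bar>g x\<bar> \<partial>M)\<^sup>2 \<le> (\<integral>x. \<bar>g x\<bar>\<^sup>2 \<partial>M)"
  proof -
    have "0 \<le> (\<integral>x. (\<bar>g x\<bar> - (\<integral>x. \<bar>g x\<bar> \<partial>M))\<^sup>2 \<partial>M)" by simp
    also have "\<dots> = (\<integral>x. \<bar>g x\<bar>\<^sup>2 \<partial>M) - (\<integral>x. \<bar>g x\<bar> \<partial>M)\<^sup>2"
      using int by (intro variance_eq) auto
    finally show ?thesis by simp
  qed
  then show "(\<integral>x. \<bar>g x\<bar> \<partial>M) \<le> l2_norm M g"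
    by (intro power2_le_imp_le[OF _ l2_norm_nonneg]) (simp add: l2_norm_power2)
qed

lemma l2_norm_Markov:
  assumes "square_integrable M g" "\<delta> > 0"
  shows "prob {x \<in> space M. \<bar>g x\<bar> > \<delta>} \<le> l2_norm M g / \<delta>"
proof -
  have [measurable]: "g \<in> borel_measurable M" using assms by (simp add: square_integrable_def)
  have "prob {x \<in> space M. \<bar>g x\<bar> > \<delta>} \<le> prob {x \<in> space M. \<bar>g x\<bar> \<ge> \<delta>}"
    by (intro finite_measure_mono) auto
  also have "\<dots> \<le> (\<integral>x. \<bar>g x\<bar> \<partial>M) / \<delta>"
    using integrable_of_square_integrable[OF assms(1)] assms(2)
    by (intro integral_Markov_inequality_measure[where A = "{}"]) auto
  also have "\<dots> \<le> l2_norm M g / \<delta>"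
    using l1_le_l2_norm[OF assms(1)] assms(2) by (intro divide_right_mono) auto
  finally show ?thesis .
qed

text \<open>On a probability space the L1 norm is below the L2 norm, so the expected sum of absolute
  values is finite and the series converges absolutely almost everywhere. The bound for the limit is
  Fatou's lemma for the squared partial sums. Where the series diverges, a null set,
  \<open>suminf\<close> has an unspecified value.\<close>

lemma
  fixes h :: "nat \<Rightarrow> 'a \<Rightarrow> real"
  assumes sq: "\<And>m. square_integrable M (h m)" and le: "\<And>m. l2_norm M (h m) \<le> e m"
    and e: "summable e"
  shows AE_summable_of_l2: "AE x in M. summable (\<lambda>m. \<bar>h m x\<bar>)"
    and square_integrable_suminf: "square_integrable M (\<lambda>x. \<Sum>m. h m x)"
    and l2_norm_suminf: "l2_norm M (\<lambda>x. \<Sum>m. h m x) \<le> (\<Sum>m. e m)"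
proof -
  have [measurable]: "h m \<in> borel_measurable M" for m using sq by (simp add: square_integrable_def)
  have e0: "0 \<le> e m" for m using le[of m] l2_norm_nonneg[of M "h m"] by linarith
  have "(\<integral>\<^sup>+x. (\<Sum>m. ennreal \<bar>h m x\<bar>) \<partial>M) = (\<Sum>m. \<integral>\<^sup>+x. ennreal \<bar>h m x\<bar> \<partial>M)"
    by (rule nn_integral_suminf) auto
  also have "\<dots> \<le> (\<Sum>m. ennreal (e m))"
  proof (rule suminf_le)
    fix m
    have "(\<integral>\<^sup>+x. ennreal \<bar>h m x\<bar> \<partial>M) = ennreal (\<integral>x. \<bar>h m x\<bar> \<partial>M)"
      using integrable_of_square_integrable[OF sq] by (intro nn_integral_eq_integral) auto
    also have "\<dots> \<le> ennreal (e m)"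
      using l1_le_l2_norm[OF sq] le by (intro ennreal_leI) (rule order_trans)
    finally show "(\<integral>\<^sup>+x. ennreal \<bar>h m x\<bar> \<partial>M) \<le> ennreal (e m)" .
  qed auto
  also have "\<dots> < \<infinity>" using suminf_ennreal2[OF e0 e] by simp
  finally have "AE x in M. (\<Sum>m. ennreal \<bar>h m x\<bar>) \<noteq> \<infinity>"
    by (intro nn_integral_PInf_AE) auto
  then show AE: "AE x in M. summable (\<lambda>m. \<bar>h m x\<bar>)"
    by eventually_elim (auto intro: summable_suminf_not_top)
  define E where "E = (\<Sum>m. e m)"
  have E0: "E \<ge> 0" unfolding E_def by (intro suminf_nonneg e e0)
  define g where "g x = (\<Sum>m. h m x)" for x
  have [measurable]: "g \<in> borel_measurable M" unfolding g_def by measurable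
  have "(\<integral>\<^sup>+x. ennreal ((g x)\<^sup>2) \<partial>M)
      = (\<integral>\<^sup>+x. liminf (\<lambda>K. ennreal ((\<Sum>m<K. h m x)\<^sup>2)) \<partial>M)"
  proof (rule nn_integral_cong_AE)
    show "AE x in M. ennreal ((g x)\<^sup>2) = liminf (\<lambda>K. ennreal ((\<Sum>m<K. h m x)\<^sup>2))"
      using AE
    proof eventually_elim
      case (elim x)
      then have "(\<lambda>K. \<Sum>m<K. h m x) \<longlonglongrightarrow> g x"
        unfolding g_def by (intro summable_LIMSEQ) (rule summable_rabs_cancel)
      then have "(\<lambda>K. ennreal ((\<Sum>m<K. h m x)\<^sup>2)) \<longlonglongrightarrow> ennreal ((g x)\<^sup>2)"
        by (intro tendsto_ennrealI tendsto_power)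
      then show ?case by (rule lim_imp_Liminf[OF sequentially_bot, symmetric])
    qed
  qed
  also have "\<dots> \<le> liminf (\<lambda>K. \<integral>\<^sup>+x. ennreal ((\<Sum>m<K. h m x)\<^sup>2) \<partial>M)"
    by (rule nn_integral_liminf) auto
  also have "\<dots> \<le> ennreal (E\<^sup>2)"
  proof (rule Liminf_le)
    show "eventually (\<lambda>K. (\<integral>\<^sup>+x. ennreal ((\<Sum>m<K. h m x)\<^sup>2) \<partial>M) \<le> ennreal (E\<^sup>2)) sequentially"
    proof (intro always_eventually allI)
      fix K
      have sK: "square_integrable M (\<lambda>x. \<Sum>m<K. h m x)" by (intro square_integrable_sum sq)
      have "l2_norm M (\<lambda>x. \<Sum>m<K. h m x) \<le> (\<Sum>m<K. l2_norm M (h m))" by (intro l2_norm_sum sq)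
      also have "\<dots> \<le> (\<Sum>m<K. e m)" by (intro sum_mono le)
      also have "\<dots> \<le> E" unfolding E_def by (intro sum_le_suminf e) (auto simp: e0)
      finally have "(l2_norm M (\<lambda>x. \<Sum>m<K. h m x))\<^sup>2 \<le> E\<^sup>2" by (intro power_mono l2_norm_nonneg)
      moreover have "(\<integral>\<^sup>+x. ennreal ((\<Sum>m<K. h m x)\<^sup>2) \<partial>M) = ennreal ((l2_norm M (\<lambda>x. \<Sum>m<K. h m x))\<^sup>2)"
        unfolding l2_norm_power2 using sK
        by (intro nn_integral_eq_integral) (auto simp: square_integrable_def)
      ultimately show "(\<integral>\<^sup>+x. ennreal ((\<Sum>m<K. h m x)\<^sup>2) \<partial>M) \<le> ennreal (E\<^sup>2)"
        by (simp add: ennreal_leI)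
    qed
  qed simp
  finally have fin: "(\<integral>\<^sup>+x. ennreal ((g x)\<^sup>2) \<partial>M) \<le> ennreal (E\<^sup>2)" .
  then have int: "integrable M (\<lambda>x. (g x)\<^sup>2)"
    by (intro integrableI_nonneg) (auto intro: le_less_trans)
  then show "square_integrable M (\<lambda>x. \<Sum>m. h m x)"
    by (simp add: square_integrable_def g_def[symmetric])
  have "ennreal (\<integral>x. (g x)\<^sup>2 \<partial>M) \<le> ennreal (E\<^sup>2)"
    using fin nn_integral_eq_integral[OF int] by simp
  then have "(\<integral>x. (g x)\<^sup>2 \<partial>M) \<le> E\<^sup>2" by (simp add: ennreal_le_iff)
  then show "l2_norm M (\<lambda>x. \<Sum>m. h m x) \<le> (\<Sum>m. e m)"
    unfolding l2_norm_def g_def[symmetric] E_def[symmetric] using E0 by (intro real_le_lsqrt) auto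
qed

text \<open>A form of Slutsky's theorem with comparison variables of one common law: the
  distribution function of \<open>X k\<close> at x is squeezed between those of \<mu> at x -
  \<delta> and x + \<delta>, up to the probability of a gap above \<delta>.\<close>

lemma weak_conv_m_of_close_in_prob:
  fixes X W :: "nat \<Rightarrow> 'a \<Rightarrow> real"
  assumes [measurable]: "\<And>k. X k \<in> borel_measurable M" "\<And>k. W k \<in> borel_measurable M"
    and law: "\<And>k. distr M borel (W k) = \<mu>"
    and close: "\<And>\<delta>. \<delta> > 0 \<Longrightarrow> (\<lambda>k. prob {x \<in> space M. \<bar>X k x - W k x\<bar> > \<delta>}) \<longlonglongrightarrow> 0"
  shows "weak_conv_m (\<lambda>k. distr M borel (X k)) \<mu>"
  unfolding weak_conv_m_def weak_conv_def
proof (intro allI impI)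
  fix x assume cont: "isCont (cdf \<mu>) x"
  have cdfX: "cdf (distr M borel (X k)) y = prob {\<omega> \<in> space M. X k \<omega> \<le> y}" for k y
    unfolding cdf_def by (subst measure_distr) (auto intro!: arg_cong[where f = prob])
  have cdfW: "cdf \<mu> y = prob {\<omega> \<in> space M. W k \<omega> \<le> y}" for k y
    unfolding cdf_def law[of k, symmetric] by (subst measure_distr) (auto intro!: arg_cong[where f = prob])
  show "(\<lambda>k. cdf (distr M borel (X k)) x) \<longlonglongrightarrow> cdf \<mu> x"
  proof (rule LIMSEQ_I)
    fix e :: real assume "e > 0"
    then obtain d where d: "d > 0" "\<And>y. \<bar>y - x\<bar> < d \<Longrightarrow> \<bar>cdf \<mu> y - cdf \<mu> x\<bar> < e / 2"
      using cont unfolding isCont_def LIM_def by (metis (no_types, opaque_lifting) dist_real_def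
          half_gt_zero cancel_comm_monoid_add_class.diff_cancel abs_zero)
    define \<delta> where "\<delta> = d / 2"
    have \<delta>: "\<delta> > 0" "\<bar>cdf \<mu> (x + \<delta>) - cdf \<mu> x\<bar> < e / 2" "\<bar>cdf \<mu> (x - \<delta>) - cdf \<mu> x\<bar> < e / 2"
      using d by (auto simp: \<delta>_def)
    obtain K where K: "\<And>k. k \<ge> K \<Longrightarrow> prob {\<omega> \<in> space M. \<bar>X k \<omega> - W k \<omega>\<bar> > \<delta>} < e / 2"
      using LIMSEQ_D[OF close[OF \<delta>(1)], of "e / 2"] \<open>e > 0\<close> by auto
    have "norm (cdf (distr M borel (X k)) x - cdf \<mu> x) < e" if "k \<ge> K" for k
    proof -
      let ?D = "{\<omega> \<in> space M. \<bar>X k \<omega> - W k \<omega>\<bar> > \<delta>}"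
      have "prob {\<omega> \<in> space M. X k \<omega> \<le> x} \<le> prob ({\<omega> \<in> space M. W k \<omega> \<le> x + \<delta>} \<union> ?D)"
        by (intro finite_measure_mono) auto
      also have "\<dots> \<le> prob {\<omega> \<in> space M. W k \<omega> \<le> x + \<delta>} + prob ?D"
        by (intro measure_Un_le) auto
      finally have 1: "cdf (distr M borel (X k)) x \<le> cdf \<mu> (x + \<delta>) + prob ?D"
        by (simp add: cdfX cdfW[of _ k])
      have "prob {\<omega> \<in> space M. W k \<omega> \<le> x - \<delta>} \<le> prob ({\<omega> \<in> space M. X k \<omega> \<le> x} \<union> ?D)"
        by (intro finite_measure_mono) auto
      also have "\<dots> \<le> prob {\<omega> \<in> space M. X k \<omega> \<le> x} + prob ?D"
        by (intro measure_Un_le) auto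
      finally have 2: "cdf \<mu> (x - \<delta>) \<le> cdf (distr M borel (X k)) x + prob ?D"
        by (simp add: cdfX cdfW[of _ k])
      from 1 2 K[OF that] \<delta> show ?thesis unfolding real_norm_def by linarith
    qed
    then show "\<exists>K. \<forall>k\<ge>K. norm (cdf (distr M borel (X k)) x - cdf \<mu> x) < e" by blast
  qed
qed

end

text \<open>Integrals over events characterise a conditional expectation, whence the indicator; with
  A the whole space the same exchange gives the mean of the series.\<close>

lemma (in prob_space) integral_suminf_l2:
  fixes h :: "nat \<Rightarrow> 'a \<Rightarrow> real"
  assumes sq: "\<And>m. square_integrable M (h m)" and le: "\<And>m. l2_norm M (h m) \<le> e m"
    and e: "summable e" and [measurable]: "A \<in> sets M"
  shows "(\<integral>x. indicator A x * (\<Sum>m. h m x) \<partial>M) = (\<Sum>m. \<integral>x. indicator A x * h m x \<partial>M)"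
proof -
  have [measurable]: "h m \<in> borel_measurable M" for m using sq by (simp add: square_integrable_def)
  have AE: "AE x in M. summable (\<lambda>m. \<bar>h m x\<bar>)" by (rule AE_summable_of_l2[OF sq le e])
  have int: "integrable M (\<lambda>x. indicator A x * h m x)" for m
    using integrable_mult_indicator[OF _ integrable_of_square_integrable[OF sq], of A m] by simp
  have "(\<integral>x. indicator A x * (\<Sum>m. h m x) \<partial>M) = (\<integral>x. (\<Sum>m. indicator A x * h m x) \<partial>M)"
  proof (rule integral_cong_AE)
    show "AE x in M. indicator A x * (\<Sum>m. h m x) = (\<Sum>m. indicator A x * h m x)"
      using AE by eventually_elim (rule suminf_mult[symmetric], rule summable_rabs_cancel)
  qed measurable
  also have "\<dots> = (\<Sum>m. \<integral>x. indicator A x * h m x \<partial>M)"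
  proof (rule integral_suminf[OF int])
    show "AE x in M. summable (\<lambda>m. norm (indicator A x * h m x))"
      using AE
    proof eventually_elim
      case (elim x)
      then show ?case
        by (rule summable_comparison_test'[where N = 0]) (simp add: indicator_def)
    qed
    show "summable (\<lambda>m. \<integral>x. norm (indicator A x * h m x) \<partial>M)"
    proof (rule summable_comparison_test'[OF e, where N = 0])
      fix m
      have "(\<integral>x. norm (indicator A x * h m x) \<partial>M) \<le> (\<integral>x. \<bar>h m x\<bar> \<partial>M)"
        using integrable_of_square_integrable[OF sq] int
        by (intro integral_mono integrable_norm integrable_abs) (auto simp: indicator_def)
      also have "\<dots> \<le> e m" using l1_le_l2_norm[OF sq] le by (rule order_trans)
      finally show "norm (\<integral>x. norm (indicator A x * h m x) \<partial>M) \<le> e m" by simp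
    qed
  qed
  finally show ?thesis .
qed

text \<open>The remainder contributes c, and exchanging one normalisation for the other contributes
  at most c again, as the norms of S and W differ by no more than the remainder. The denominator is
  there because the norm of S may be as small as 1 - c times that of W.\<close>

lemma (in prob_space)
  assumes S: "square_integrable M S" and W: "square_integrable M W" and c: "c < 1"
    and pos: "0 < l2_norm M W" and le: "l2_norm M (\<lambda>x. S x - W x) \<le> c * l2_norm M W"
  shows l2_norm_pos_of_close: "0 < l2_norm M S"
    and square_integrable_normalized_diff:
      "square_integrable M (\<lambda>x. S x / l2_norm M S - W x / l2_norm M W)"
    and l2_norm_normalized_diff:
      "l2_norm M (\<lambda>x. S x / l2_norm M S - W x / l2_norm M W) \<le> 2 * c / (1 - c)"
proof -
  define \<sigma> where "\<sigma> = l2_norm M S"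
  define \<tau> where "\<tau> = l2_norm M W"
  define R where "R = (\<lambda>x. S x - W x)"
  define \<rho> where "\<rho> = l2_norm M R"
  have R: "square_integrable M R"
    using square_integrable_add[OF S square_integrable_cmult[OF W, of "-1"]] by (simp add: R_def)
  have \<rho>: "\<rho> \<le> c * \<tau>" using le by (simp add: \<rho>_def R_def \<tau>_def)
  have "\<sigma> \<le> \<tau> + \<rho>"
    using l2_norm_triangle[OF W R] by (simp add: \<sigma>_def \<tau>_def \<rho>_def R_def)
  moreover have "\<tau> \<le> \<sigma> + \<rho>"
    using l2_norm_triangle[OF S square_integrable_cmult[OF R, of "-1"]] l2_norm_cmult[of M "-1" R]
    by (simp add: \<sigma>_def \<tau>_def \<rho>_def R_def)
  ultimately have abs: "\<bar>\<tau> - \<sigma>\<bar> \<le> \<rho>" by simp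
  have \<sigma>: "(1 - c) * \<tau> \<le> \<sigma>" using \<open>\<tau> \<le> \<sigma> + \<rho>\<close> \<rho> by (simp add: left_diff_distrib)
  have \<tau>: "0 < \<tau>" using pos by (simp add: \<tau>_def)
  have "0 < (1 - c) * \<tau>" using c \<tau> by simp
  then have \<sigma>0: "0 < \<sigma>" using \<sigma> by linarith
  then show "0 < l2_norm M S" by (simp add: \<sigma>_def)
  have eq: "S x / \<sigma> - W x / \<tau> = 1 / \<sigma> * R x + (1 / \<sigma> - 1 / \<tau>) * W x" for x
    using \<sigma>0 \<tau> by (simp add: R_def field_simps)
  note sq = square_integrable_cmult[OF R, of "1 / \<sigma>"] square_integrable_cmult[OF W, of "1 / \<sigma> - 1 / \<tau>"]
  show "square_integrable M (\<lambda>x. S x / l2_norm M S - W x / l2_norm M W)"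
    unfolding \<sigma>_def[symmetric] \<tau>_def[symmetric] eq by (rule square_integrable_add[OF sq])
  have "l2_norm M (\<lambda>x. S x / \<sigma> - W x / \<tau>) \<le> \<bar>1 / \<sigma>\<bar> * \<rho> + \<bar>1 / \<sigma> - 1 / \<tau>\<bar> * \<tau>"
    using l2_norm_triangle[OF sq] by (simp only: eq l2_norm_cmult \<rho>_def \<tau>_def[symmetric])
  also have "\<bar>1 / \<sigma> - 1 / \<tau>\<bar> * \<tau> = \<bar>\<tau> - \<sigma>\<bar> / \<sigma>"
  proof -
    have "1 / \<sigma> - 1 / \<tau> = (\<tau> - \<sigma>) / (\<sigma> * \<tau>)" using \<sigma>0 \<tau> by (simp add: diff_frac_eq)
    then show ?thesis using \<sigma>0 \<tau> by (simp add: abs_mult)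
  qed
  also have "\<bar>1 / \<sigma>\<bar> * \<rho> + \<bar>\<tau> - \<sigma>\<bar> / \<sigma> = (\<rho> + \<bar>\<tau> - \<sigma>\<bar>) / \<sigma>"
    using \<sigma>0 by (simp add: add_divide_distrib)
  also have "\<dots> \<le> (2 * (c * \<tau>)) / \<sigma>"
    using \<sigma>0 abs \<rho> by (intro divide_right_mono) auto
  also have "\<dots> \<le> (2 * (c * \<tau>)) / ((1 - c) * \<tau>)"
  proof -
    have "0 \<le> \<rho>" by (simp add: \<rho>_def l2_norm_nonneg)
    with \<rho> have "0 \<le> c * \<tau>" by linarith
    then show ?thesis using \<sigma> \<sigma>0 c \<tau> by (intro divide_left_mono mult_pos_pos) auto
  qed
  also have "\<dots> = 2 * c / (1 - c)" using \<tau> by simp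
  finally show "l2_norm M (\<lambda>x. S x / l2_norm M S - W x / l2_norm M W) \<le> 2 * c / (1 - c)"
    by (simp add: \<sigma>_def \<tau>_def)
qed

section \<open>Bernoulli shifts\<close>

definition shift :: "(int \<Rightarrow> 'b) \<Rightarrow> int \<Rightarrow> 'b" where
  "shift x = (\<lambda>i. x (i + 1))"

lemma shift_funpow: "(shift ^^ n) x = (\<lambda>i. x (i + int n))"
  by (induction n) (auto simp: shift_def algebra_simps)

text \<open>Given by generators, so that a pullback along \<open>shift\<close> need only be computed
  on them, where it moves the index j to j + 1.\<close>

definition past :: "'b measure \<Rightarrow> int \<Rightarrow> (int \<Rightarrow> 'b) measure" where
  "past S i = sigma (UNIV \<rightarrow> space S) {(\<lambda>x. x j) -` B \<inter> (UNIV \<rightarrow> space S) |j B. j \<le> i \<and> B \<in> sets S}"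

locale bernoulli_shift = alphabet: prob_space S for S :: "'b measure"
begin

abbreviation M :: "(int \<Rightarrow> 'b) measure" where
  "M \<equiv> Pi\<^sub>M UNIV (\<lambda>_. S)"

sublocale prob_space M
  by (intro prob_space_PiM alphabet.prob_space_axioms)

lemma space_M: "space M = UNIV \<rightarrow> space S"
  by (simp add: space_PiM PiE_UNIV_domain Pi_def)

lemma measurable_reindex: "(\<lambda>x i. x (g i)) \<in> measurable M M"
  by (rule measurable_PiM_single') (auto simp: space_PiM PiE_UNIV_domain)

lemma distr_shift: "distr M M shift = M"
proof -
  have "distr M (Pi\<^sub>M UNIV (\<lambda>_. S)) (\<lambda>\<omega>. \<lambda>i\<in>UNIV. \<omega> (i + 1)) = Pi\<^sub>M UNIV (\<lambda>_. S)"
    using distr_PiM_reindex[of UNIV "\<lambda>_. S" "\<lambda>i::int. i + 1" UNIV]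
    by (simp add: alphabet.prob_space_axioms)
  moreover have "shift = (\<lambda>\<omega>. \<lambda>i\<in>UNIV. \<omega> (i + 1 :: int) :: 'b)" by (simp add: fun_eq_iff shift_def)
  ultimately show ?thesis by simp
qed

lemma shift_measurable[measurable]: "shift \<in> measurable M M"
  unfolding shift_def by (rule measurable_reindex)

lemma shift_funpow_measurable: "(shift ^^ n) \<in> measurable M M"
  by (rule measurable_compose_n) (rule shift_measurable)

lemma shift_in_space[simp]: "x \<in> space M \<Longrightarrow> shift x \<in> space M"
  by (rule measurable_space[OF shift_measurable])

lemma shift_funpow_vimage:
  "(shift ^^ Suc n) -` A \<inter> space M = shift -` ((shift ^^ n) -` A \<inter> space M) \<inter> space M"
  unfolding funpow_Suc_right by auto

lemma measure_shift_funpow: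
  assumes "A \<in> sets M"
  shows "prob ((shift ^^ n) -` A \<inter> space M) = prob A"
proof (induction n)
  case 0
  show ?case using sets.sets_into_space[OF assms] by (simp add: Int_absorb2)
next
  case (Suc n)
  have "prob ((shift ^^ Suc n) -` A \<inter> space M) = measure (distr M M shift) ((shift ^^ n) -` A \<inter> space M)"
    unfolding shift_funpow_vimage
    by (rule measure_distr[OF shift_measurable measurable_sets[OF shift_funpow_measurable assms], symmetric])
  also have "\<dots> = prob A" unfolding distr_shift by (rule Suc)
  finally show ?case .
qed

lemma dynamical_system_shift: "dynamical_system M shift"
proof (unfold_locales)
  have inv: "shift (\<lambda>i. x (i - 1)) = x" "(\<lambda>i. shift x (i - 1)) = x" for x :: "int \<Rightarrow> 'b"
    by (auto simp: shift_def)
  show bij: "bij_betw shift (space M) (space M)"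
  proof (rule bij_betw_byWitness[where f' = "\<lambda>x i. x (i - 1)"])
    show "\<forall>x\<in>space M. (\<lambda>i. shift x (i - 1)) = x" "\<forall>x\<in>space M. shift (\<lambda>i. x (i - 1)) = x"
      by (simp_all add: inv)
  qed (auto simp: space_M shift_def)
  have "the_inv_into (space M) shift x = (\<lambda>i. x (i - 1))" if "x \<in> space M" for x
    by (rule the_inv_into_f_eq[OF bij_betw_imp_inj_on[OF bij]]) (use that in \<open>simp_all add: inv space_M Pi_iff\<close>)
  then show "the_inv_into (space M) shift \<in> measurable M M"
    by (rule measurable_cong[THEN iffD2, OF _ measurable_reindex[of "\<lambda>i. i - 1"]])
  show "shift \<in> measurable M M" by (rule shift_measurable)
  show "distr M M shift = M" by (rule distr_shift)
qed

section \<open>Cylinders, mixing and ergodicity\<close>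

definition cylinder :: "int set \<Rightarrow> (int \<Rightarrow> 'b set) \<Rightarrow> (int \<Rightarrow> 'b) set" where
  "cylinder J X = {x \<in> space M. \<forall>i\<in>J. x i \<in> X i}"

lemma cylinder_eq_prod_emb:
  "cylinder J X = prod_emb UNIV (\<lambda>_. S) J (Pi\<^sub>E J X)"
  by (auto simp: cylinder_def prod_emb_def space_M restrict_PiE_iff PiE_UNIV_domain Pi_iff)

lemma
  assumes "finite J" "\<And>i. i \<in> J \<Longrightarrow> X i \<in> sets S"
  shows cylinder_measurable: "cylinder J X \<in> sets M"
    and measure_cylinder: "prob (cylinder J X) = (\<Prod>i\<in>J. measure S (X i))"
proof -
  show "cylinder J X \<in> sets M"
    unfolding cylinder_eq_prod_emb using assms by (intro sets_PiM_I) auto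
  have "emeasure M (cylinder J X) = (\<Prod>i\<in>J. emeasure S (X i))"
    unfolding cylinder_eq_prod_emb
    by (rule emeasure_PiM_emb) (use assms in \<open>auto intro: alphabet.prob_space_axioms\<close>)
  then show "prob (cylinder J X) = (\<Prod>i\<in>J. measure S (X i))"
    by (simp add: emeasure_eq_measure alphabet.emeasure_eq_measure prod_ennreal prod_nonneg)
qed

lemma prod_algebra_eq_cylinder:
  assumes "A \<in> prod_algebra UNIV (\<lambda>_. S)"
  obtains J X where "finite J" "\<And>i. i \<in> J \<Longrightarrow> X i \<in> sets S" "A = cylinder J X"
  using assms by (elim prod_algebraE) (auto simp: cylinder_eq_prod_emb)

text \<open>Once n exceeds twice a bound on the absolute indices, the translate J + n misses J', so
  both events together form one cylinder whose probability factors. From then on the equality is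
  exact.\<close>

lemma cylinder_shift_independent:
  assumes "finite J" "\<And>i. i \<in> J \<Longrightarrow> X i \<in> sets S" "finite J'" "\<And>i. i \<in> J' \<Longrightarrow> X' i \<in> sets S"
  shows "eventually (\<lambda>n. prob (cylinder J' X' \<inter> ((shift ^^ n) -` cylinder J X \<inter> space M)) =
    prob (cylinder J' X') * prob (cylinder J X)) sequentially"
proof -
  obtain b where b: "\<And>i. i \<in> J \<union> J' \<Longrightarrow> \<bar>i\<bar> \<le> b"
    using finite_imageI[of "J \<union> J'" abs] assms by (metis Max_ge finite_Un imageI)
  have "prob (cylinder J' X' \<inter> ((shift ^^ n) -` cylinder J X \<inter> space M)) =
    prob (cylinder J' X') * prob (cylinder J X)" if n: "n \<ge> nat (2 * b + 1)" for n
  proof -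
    let ?s = "\<lambda>i. i + int n"
    let ?Y = "\<lambda>i. if i \<in> J' then X' i else X (i - int n)"
    have disj: "?s i \<notin> J'" if "i \<in> J" for i
      using b[of i] b[of "?s i"] that n by auto
    have "cylinder J' X' \<inter> ((shift ^^ n) -` cylinder J X \<inter> space M) = cylinder (J' \<union> ?s ` J) ?Y"
    proof -
      have "(\<forall>i\<in>J' \<union> ?s ` J. x i \<in> ?Y i) \<longleftrightarrow> (\<forall>i\<in>J'. x i \<in> X' i) \<and> (\<forall>i\<in>J. x (?s i) \<in> X i)" for x
        using disj by (simp add: ball_Un cong: ball_cong)
      then show ?thesis by (auto simp: cylinder_def shift_funpow space_M)
    qed
    also have "prob \<dots> = (\<Prod>i\<in>J' \<union> ?s ` J. measure S (?Y i))"
      using assms disj by (intro measure_cylinder) auto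
    also have "\<dots> = (\<Prod>i\<in>J'. measure S (?Y i)) * (\<Prod>i\<in>?s ` J. measure S (?Y i))"
      using assms disj by (intro prod.union_disjoint) auto
    also have "(\<Prod>i\<in>?s ` J. measure S (?Y i)) = (\<Prod>i\<in>J. measure S (X i))"
      using disj by (subst prod.reindex) (auto intro!: prod.cong simp: inj_on_def)
    finally show ?thesis using assms by (simp add: measure_cylinder)
  qed
  then show ?thesis unfolding eventually_sequentially by blast
qed

text \<open>A Dynkin argument in B with the cylinder held fixed; on generators the sequence is
  eventually constant. Complements use that the shift preserves the measure, disjoint unions that a
  limit may be exchanged with a series.\<close>

lemma shift_mixing:
  assumes "B \<in> sets M" and J: "finite J" "\<And>i. i \<in> J \<Longrightarrow> X i \<in> sets S"
  shows "(\<lambda>n. prob (B \<inter> ((shift ^^ n) -` cylinder J X \<inter> space M))) \<longlonglongrightarrow> prob B * prob (cylinder J X)"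
proof -
  define G where "G n = (shift ^^ n) -` cylinder J X \<inter> space M" for n
  have [measurable]: "cylinder J X \<in> sets M" by (rule cylinder_measurable) (use J in auto)
  have G[measurable]: "G n \<in> sets M" for n
    unfolding G_def by (rule measurable_sets[OF shift_funpow_measurable]) measurable
  have prob_G: "prob (G n) = prob (cylinder J X)" for n
    unfolding G_def by (rule measure_shift_funpow) auto
  have "B \<in> sigma_sets (\<Pi>\<^sub>E i\<in>UNIV. space S) (prod_algebra UNIV (\<lambda>_. S))"
    using assms(1) by (simp add: sets_PiM)
  with Int_stable_prod_algebra prod_algebra_sets_into_space
  have "(\<lambda>n. prob (B \<inter> G n)) \<longlonglongrightarrow> prob B * prob (cylinder J X)"
  proof (induction rule: sigma_sets_induct_disjoint)
    case (basic A)
    then obtain J' X' where J': "finite J'" "\<And>i. i \<in> J' \<Longrightarrow> X' i \<in> sets S" and A: "A = cylinder J' X'"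
      by (rule prod_algebra_eq_cylinder) auto
    show ?case
      unfolding A G_def using cylinder_shift_independent[OF J J'] by (rule tendsto_eventually)
  next
    case (compl A)
    then have [measurable]: "A \<in> sets M" by (simp add: sets_PiM)
    have eq1: "prob ((\<Pi>\<^sub>E i\<in>UNIV. space S) - A) = 1 - prob A"
      using prob_compl[of A] by (simp add: space_PiM)
    have eq2: "prob (((\<Pi>\<^sub>E i\<in>UNIV. space S) - A) \<inter> G n) = prob (cylinder J X) - prob (A \<inter> G n)" for n
    proof -
      have "((\<Pi>\<^sub>E i\<in>UNIV. space S) - A) \<inter> G n = G n - A \<inter> G n"
        using sets.sets_into_space[OF G[of n]] by (auto simp: space_PiM)
      then show ?thesis by (simp add: finite_measure_Diff prob_G)
    qed
    show ?case
      unfolding eq1 eq2 left_diff_distrib mult_1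
      by (intro tendsto_diff tendsto_const compl(2))
  next
    case (union A)
    then have [measurable]: "\<And>k. A k \<in> sets M" by (auto simp: sets_PiM)
    have sums: "(\<lambda>k. prob (A k)) sums prob (\<Union>k. A k)"
      by (rule finite_measure_UNION) (use union in auto)
    have sumsG: "(\<lambda>k. prob (A k \<inter> G n)) sums prob ((\<Union>k. A k) \<inter> G n)" for n
    proof -
      have "(\<lambda>k. prob (A k \<inter> G n)) sums prob (\<Union>k. A k \<inter> G n)"
        by (rule finite_measure_UNION) (use union in \<open>auto simp: disjoint_family_on_def\<close>)
      then show ?thesis by (simp add: Int_UN_distrib2)
    qed
    \<comment> \<open>Tannery's theorem: uniformly in n the terms are dominated by
      \<open>prob (A k)\<close>, which is summable by disjointness.\<close>
    have "(\<lambda>n. \<Sum>k. prob (A k \<inter> G n)) \<longlonglongrightarrow> (\<Sum>k. prob (A k) * prob (cylinder J X))"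
    proof (rule tannerys_theorem[THEN conjunct2, THEN conjunct2])
      show "(\<lambda>n. prob (A k \<inter> G n)) \<longlonglongrightarrow> prob (A k) * prob (cylinder J X)" for k
        by (rule union(3))
      show "eventually (\<lambda>(k, n). norm (prob (A k \<inter> G n)) \<le> prob (A k)) (at_top \<times>\<^sub>F sequentially)"
        by (intro always_eventually) (auto intro: finite_measure_mono)
      show "summable (\<lambda>k. prob (A k))" using sums by (rule sums_summable)
    qed simp
    then show ?case
      using sums sumsG by (simp add: sums_iff suminf_mult2 [symmetric])
  qed auto
  then show ?thesis by (simp add: G_def)
qed

text \<open>By mixing, an invariant event is independent of every cylinder, hence of itself.\<close>

lemma ergodic_shift: "ergodic_dynamical_system M shift"
proof -
  interpret D: dynamical_system M shift by (rule dynamical_system_shift)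
  show ?thesis
  proof unfold_locales
    fix A assume A[measurable]: "A \<in> sets M" and inv: "A = shift -` A \<inter> space M"
    have invn: "A = (shift ^^ n) -` A \<inter> space M" for n
    proof (induction n)
      case 0
      then show ?case using sets.sets_into_space[OF A] by auto
    next
      case (Suc n)
      with inv show ?case unfolding shift_funpow_vimage by simp
    qed
    have "prob (A \<inter> E) = prob A * prob E"
      if "E \<in> sigma_sets (\<Pi>\<^sub>E i\<in>UNIV. space S) (prod_algebra UNIV (\<lambda>_. S))" for E
      using Int_stable_prod_algebra prod_algebra_sets_into_space that
    proof (induction rule: sigma_sets_induct_disjoint)
      case (basic E)
      then obtain J X where J: "finite J" "\<And>i. i \<in> J \<Longrightarrow> X i \<in> sets S" and E: "E = cylinder J X"
        by (rule prod_algebra_eq_cylinder) auto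
      have "E \<in> sets M" unfolding E by (rule cylinder_measurable) (use J in auto)
      have "prob (A \<inter> ((shift ^^ n) -` E \<inter> space M)) = prob (A \<inter> E)" for n
      proof -
        have "A \<inter> ((shift ^^ n) -` E \<inter> space M) = (shift ^^ n) -` (A \<inter> E) \<inter> space M"
          using invn[of n] by auto
        then show ?thesis using measure_shift_funpow[of "A \<inter> E" n] \<open>E \<in> sets M\<close> by simp
      qed
      moreover have "(\<lambda>n. prob (A \<inter> ((shift ^^ n) -` E \<inter> space M))) \<longlonglongrightarrow> prob A * prob E"
        unfolding E by (rule shift_mixing) (use A J in auto)
      ultimately show ?case by (simp add: LIMSEQ_const_iff)
    next
      case (compl E)
      then have [measurable]: "E \<in> sets M" by (simp add: sets_PiM)
      have "A \<inter> ((\<Pi>\<^sub>E i\<in>UNIV. space S) - E) = A - A \<inter> E"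
        using sets.sets_into_space[OF A] by (auto simp: space_PiM)
      then have "prob (A \<inter> ((\<Pi>\<^sub>E i\<in>UNIV. space S) - E)) = prob A - prob (A \<inter> E)"
        by (simp add: finite_measure_Diff)
      moreover have "prob ((\<Pi>\<^sub>E i\<in>UNIV. space S) - E) = 1 - prob E"
        using prob_compl[of E] by (simp add: space_PiM)
      ultimately show ?case using compl(2) by (simp add: right_diff_distrib)
    next
      case (union E)
      then have [measurable]: "\<And>k. E k \<in> sets M" by (auto simp: sets_PiM)
      have "(\<lambda>k. prob (E k)) sums prob (\<Union>k. E k)"
        by (rule finite_measure_UNION) (use union in auto)
      from sums_mult[OF this, of "prob A"]
      have "(\<lambda>k. prob (A \<inter> E k)) sums (prob A * prob (\<Union>k. E k))"
        by (simp add: union(3))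
      moreover have "(\<lambda>k. prob (A \<inter> E k)) sums prob (\<Union>k. A \<inter> E k)"
        by (rule finite_measure_UNION) (use union in \<open>auto simp: disjoint_family_on_def\<close>)
      ultimately show ?case by (auto dest: sums_unique2)
    qed auto
    from this[of A] A have "prob A = prob A * prob A" by (simp add: sets_PiM)
    then show "prob A \<in> {0, 1}" by auto
  qed
qed

section \<open>The filtration of the past and its independence of the future\<close>

lemma
  shows space_past: "space (past S i) = space M"
    and sets_past: "sets (past S i) =
      sigma_sets (space M) {(\<lambda>x. x j) -` B \<inter> space M |j B. j \<le> i \<and> B \<in> sets S}"
  unfolding past_def space_M by (auto intro!: space_measure_of sets_measure_of)

lemma sets_past_mono: "i \<le> j \<Longrightarrow> sets (past S i) \<subseteq> sets (past S j)"
  unfolding sets_past by (rule sigma_sets_subseteq) (blast intro: order_trans)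

lemma subalgebra_past: "subalgebra M (past S i)"
proof -
  have "{(\<lambda>x. x j) -` B \<inter> space M |j B. j \<le> i \<and> B \<in> sets S} \<subseteq> sets M"
    by (auto intro!: measurable_sets[where A = S])
  then show ?thesis
    by (simp add: subalgebra_def space_past sets_past sets.sigma_sets_subset)
qed

lemma shift_vimage_past: "(\<lambda>A. shift -` A \<inter> space M) ` sets (past S i) = sets (past S (i + 1))"
proof -
  have "(\<lambda>A. shift -` A \<inter> space M) ` sets (past S i) =
      {shift -` A \<inter> space M |A. A \<in> sets (past S i)}" by auto
  also have "\<dots> = sigma_sets (space M) {shift -` A \<inter> space M |A.
      A \<in> {(\<lambda>x. x j) -` B \<inter> space M |j B. j \<le> i \<and> B \<in> sets S}}"
    unfolding sets_past by (rule sigma_sets_vimage_commute) (auto simp: space_M shift_def)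
  also have "{shift -` A \<inter> space M |A. A \<in> {(\<lambda>x. x j) -` B \<inter> space M |j B. j \<le> i \<and> B \<in> sets S}} =
      {(\<lambda>x. x j) -` B \<inter> space M |j B. j \<le> i + 1 \<and> B \<in> sets S}" (is "?L = ?R")
  proof (intro equalityI subsetI)
    fix E assume "E \<in> ?L"
    then obtain j B where "j \<le> i" "B \<in> sets S" "E = shift -` ((\<lambda>x. x j) -` B \<inter> space M) \<inter> space M"
      by auto
    then have "j + 1 \<le> i + 1" "E = (\<lambda>x. x (j + 1)) -` B \<inter> space M"
      by (auto simp: shift_def space_M Pi_iff)
    with \<open>B \<in> sets S\<close> show "E \<in> ?R" by blast
  next
    fix E assume "E \<in> ?R"
    then obtain j B where *: "j \<le> i + 1" "B \<in> sets S" "E = (\<lambda>x. x j) -` B \<inter> space M"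
      by auto
    then have "E = shift -` ((\<lambda>x. x (j - 1)) -` B \<inter> space M) \<inter> space M"
      by (auto simp: shift_def space_M Pi_iff)
    moreover have "j - 1 \<le> i" using * by simp
    ultimately show "E \<in> ?L" using \<open>B \<in> sets S\<close> by blast
  qed
  finally show ?thesis by (simp add: sets_past)
qed

lemma component_measurable_past:
  assumes "j \<le> i"
  shows "(\<lambda>x. x j) \<in> measurable (past S i) S"
proof (rule measurableI)
  show "x j \<in> space S" if "x \<in> space (past S i)" for x
    using that by (simp add: space_past space_M Pi_def)
  show "(\<lambda>x. x j) -` B \<inter> space (past S i) \<in> sets (past S i)" if "B \<in> sets S" for B
    using that assms unfolding space_past sets_past by (intro sigma_sets.Basic) auto
qed

lemma indep_components: "indep_vars (\<lambda>_. S) (\<lambda>i x. x i) UNIV"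
proof (subst indep_vars_iff_distr_eq_PiM')
  have "distr M S (\<lambda>x. x i) = S" for i :: int
    by (rule distr_PiM_component) (auto intro: alphabet.prob_space_axioms)
  then show "distr M (Pi\<^sub>M UNIV (\<lambda>_. S)) (\<lambda>x. \<lambda>i\<in>UNIV. x i) = Pi\<^sub>M UNIV (\<lambda>i. distr M S (\<lambda>x. x i))"
    by (simp add: distr_id2 restrict_UNIV)
qed auto

lemma distr_component: "distr M S (\<lambda>x. x i) = S"
  by (rule distr_PiM_component) (auto intro: alphabet.prob_space_axioms)

text \<open>An event of the past depends only on coordinates up to i and is therefore independent of
  coordinate j. For centred g this makes \<open>g (x j)\<close> orthogonal to the past.\<close>

lemma integral_past_future:
  fixes g :: "'b \<Rightarrow> real"
  assumes A: "A \<in> sets (past S i)" and "i < j" and [measurable]: "integrable S g"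
  shows "(\<integral>x. indicator A x * g (x j) \<partial>M) = prob A * (\<integral>y. g y \<partial>S)"
proof -
  have g[measurable]: "g \<in> borel_measurable S" by (rule borel_measurable_integrable) fact
  let ?R = "\<lambda>x. restrict x {..i}"
  \<comment> \<open>The generators are preimages under the restriction \<open>?R\<close>, so A is
    the pullback of an event B on the coordinates up to i; independence of disjoint groups of
    coordinates then applies.\<close>
  have "sets (past S i) \<subseteq> {?R -` B \<inter> space M |B. B \<in> sets (Pi\<^sub>M {..i} (\<lambda>_. S))}"
  proof -
    have "{(\<lambda>x. x k) -` B \<inter> space M |k B. k \<le> i \<and> B \<in> sets S}
        \<subseteq> sets (vimage_algebra (space M) ?R (Pi\<^sub>M {..i} (\<lambda>_. S)))"
    proof clarify
      fix k B assume k: "k \<le> i" and B: "B \<in> sets S"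
      have "(\<lambda>x. x k) -` B \<inter> space M = ?R -` ((\<lambda>x. x k) -` B \<inter> space (Pi\<^sub>M {..i} (\<lambda>_. S))) \<inter> space M"
        using k by (auto simp: space_PiM restrict_PiE_iff PiE_UNIV_domain Pi_iff)
      moreover have "(\<lambda>x. x k) -` B \<inter> space (Pi\<^sub>M {..i} (\<lambda>_. S)) \<in> sets (Pi\<^sub>M {..i} (\<lambda>_. S))"
        using k B by (intro measurable_sets[where A = S]) auto
      ultimately show "(\<lambda>x. x k) -` B \<inter> space M \<in> sets (vimage_algebra (space M) ?R (Pi\<^sub>M {..i} (\<lambda>_. S)))"
        by (simp only: in_vimage_algebra)
    qed
    from sets.sigma_sets_subset[OF this]
    have "sets (past S i) \<subseteq> sets (vimage_algebra (space M) ?R (Pi\<^sub>M {..i} (\<lambda>_. S)))"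
      by (simp add: sets_past)
    also have "\<dots> = {?R -` B \<inter> space M |B. B \<in> sets (Pi\<^sub>M {..i} (\<lambda>_. S))}"
      by (rule sets_vimage_algebra2) (auto simp: space_PiM restrict_PiE_iff PiE_UNIV_domain Pi_iff)
    finally show ?thesis .
  qed
  with A obtain B where B[measurable]: "B \<in> sets (Pi\<^sub>M {..i} (\<lambda>_. S))" and AB: "A = ?R -` B \<inter> space M"
    by auto
  have "indep_var (Pi\<^sub>M {..i} (\<lambda>_. S)) ?R (Pi\<^sub>M {j} (\<lambda>_. S)) (\<lambda>x. restrict x {j})"
    using indep_var_restrict[OF indep_components, of "{..i}" "{j}"] \<open>i < j\<close> by auto
  then have "indep_var borel (indicator B \<circ> ?R) borel ((\<lambda>y. g (y j)) \<circ> (\<lambda>x. restrict x {j}))"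
    by (rule indep_var_compose) auto
  then have ind: "indep_var borel (\<lambda>x. indicator B (?R x) :: real) borel (\<lambda>x. g (x j))"
    by (simp add: comp_def)
  have R[measurable]: "?R \<in> measurable M (Pi\<^sub>M {..i} (\<lambda>_. S))"
    by (rule measurable_restrict_subset) auto
  have eq: "indicator B (?R x) = (indicator A x :: real)" if "x \<in> space M" for x
    using that by (auto simp: AB indicator_def)
  have [measurable]: "A \<in> sets M" using A subalgebra_past by (auto simp: subalgebra_def)
  have "(\<integral>x. indicator A x * g (x j) \<partial>M) = (\<integral>x. indicator B (?R x) * g (x j) \<partial>M)"
    by (intro Bochner_Integration.integral_cong) (auto simp: eq)
  also have "\<dots> = (\<integral>x. indicator B (?R x) \<partial>M) * (\<integral>x. g (x j) \<partial>M)"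
  proof (rule indep_var_lebesgue_integral[OF ind])
    show "integrable M (\<lambda>x. indicator B (?R x) :: real)"
      by (rule integrable_const_bound[where B = 1]) (auto simp: indicator_def)
    have "integrable (distr M S (\<lambda>x. x j)) g" unfolding distr_component by fact
    then show "integrable M (\<lambda>x. g (x j))" by (subst (asm) integrable_distr_eq) auto
  qed
  also have "(\<integral>x. indicator B (?R x) \<partial>M) = (\<integral>x. indicator A x \<partial>M :: real)"
    by (intro Bochner_Integration.integral_cong) (auto simp: eq)
  also have "(\<integral>x. g (x j) \<partial>M) = (\<integral>y. g y \<partial>distr M S (\<lambda>x. x j))"
    by (subst integral_distr) auto
  finally show ?thesis by (simp add: distr_component)
qed

end

section \<open>Superpositions of moving averages\<close>

text \<open>One letter of the alphabet \<open>Pi\<^sub>M UNIV \<nu>\<close> is a whole sequence of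
  reals, so \<open>x i m\<close> is the innovation of component m at time i. Fixing just the first
  two moments lets the same L2 estimates serve both kinds of innovations.\<close>

locale innovation_family =
  fixes \<nu> :: "nat \<Rightarrow> real measure"
  assumes prob_space_innovation: "\<And>m. prob_space (\<nu> m)"
    and sets_innovation[measurable_cong]: "\<And>m. sets (\<nu> m) = sets borel"
    and integrable_innovation_sq: "\<And>m. integrable (\<nu> m) (\<lambda>y. y\<^sup>2)"
    and innovation_mean: "\<And>m. (\<integral>y. y \<partial>\<nu> m) = 0"
    and innovation_variance: "\<And>m. (\<integral>y. y\<^sup>2 \<partial>\<nu> m) = 1"
begin

sublocale bernoulli_shift "Pi\<^sub>M UNIV \<nu>"
  unfolding bernoulli_shift_def by (intro prob_space_PiM prob_space_innovation)

lemma alphabet_coordinate_measurable[measurable]: "(\<lambda>y. y m) \<in> borel_measurable (Pi\<^sub>M UNIV \<nu>)"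
proof -
  have "(\<lambda>y. y m) \<in> measurable (Pi\<^sub>M UNIV \<nu>) (\<nu> m)" by simp
  then show ?thesis by (simp cong: measurable_cong_sets add: sets_innovation)
qed

lemma coordinate_measurable[measurable]: "(\<lambda>x. x i m) \<in> borel_measurable M"
  by (rule measurable_compose[OF _ alphabet_coordinate_measurable]) simp

lemma distr_alphabet_coordinate: "distr (Pi\<^sub>M UNIV \<nu>) borel (\<lambda>y. y m) = \<nu> m"
proof -
  have "distr (Pi\<^sub>M UNIV \<nu>) borel (\<lambda>y. y m) = distr (Pi\<^sub>M UNIV \<nu>) (\<nu> m) (\<lambda>y. y m)"
    by (rule distr_cong) (simp_all add: sets_innovation)
  also have "\<dots> = \<nu> m" by (rule distr_PiM_component) (auto intro: prob_space_innovation)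
  finally show ?thesis .
qed

lemma distr_coordinate: "distr M borel (\<lambda>x. x i m) = \<nu> m"
proof -
  have "distr M borel (\<lambda>x. x i m) = distr (distr M (Pi\<^sub>M UNIV \<nu>) (\<lambda>x. x i)) borel (\<lambda>y. y m)"
    by (subst distr_distr) (auto simp: comp_def)
  then show ?thesis by (simp add: distr_component distr_alphabet_coordinate)
qed

lemma indep_coordinates: "indep_vars (\<lambda>_. borel) (\<lambda>i x. x i m) UNIV"
  using indep_vars_compose2[OF indep_components, of "\<lambda>_ y. y m" "\<lambda>_. borel"] by simp

lemma integrable_innovation: "integrable (\<nu> m) (\<lambda>y. y)"
proof -
  interpret innov: prob_space "\<nu> m" by (rule prob_space_innovation)
  show ?thesis
    by (rule innov.square_integrable_imp_integrable) (simp_all add: integrable_innovation_sq measurable_ident_sets sets_innovation)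
qed

lemma
  shows integrable_coordinate: "integrable M (\<lambda>x. x i m)"
    and integrable_coordinate_sq: "integrable M (\<lambda>x. (x i m)\<^sup>2)"
    and expectation_coordinate: "expectation (\<lambda>x. x i m) = 0"
    and expectation_coordinate_sq: "expectation (\<lambda>x. (x i m)\<^sup>2) = 1"
proof -
  show "integrable M (\<lambda>x. x i m)"
    using integrable_innovation[of m] unfolding distr_coordinate[of i m, symmetric]
    by (subst (asm) integrable_distr_eq) auto
  show "integrable M (\<lambda>x. (x i m)\<^sup>2)"
    using integrable_innovation_sq[of m] unfolding distr_coordinate[of i m, symmetric]
    by (subst (asm) integrable_distr_eq) auto
  show "expectation (\<lambda>x. x i m) = 0"
    using innovation_mean[of m] unfolding distr_coordinate[of i m, symmetric]
    by (subst (asm) integral_distr) auto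
  show "expectation (\<lambda>x. (x i m)\<^sup>2) = 1"
    using innovation_variance[of m] unfolding distr_coordinate[of i m, symmetric]
    by (subst (asm) integral_distr) auto
qed

lemma
  shows integrable_coordinate_mult: "integrable M (\<lambda>x. x i m * x j m)"
    and expectation_coordinate_mult: "expectation (\<lambda>x. x i m * x j m) = (if i = j then 1 else 0)"
proof -
  have "integrable M (\<lambda>x. x i m * x j m) \<and>
      expectation (\<lambda>x. x i m * x j m) = (if i = j then 1 else 0)"
  proof (cases "i = j")
    case True
    then show ?thesis
      using integrable_coordinate_sq[of j m] expectation_coordinate_sq[of j m]
      by (simp add: power2_eq_square)
  next
    case False
    have "indep_vars (\<lambda>_. borel) (\<lambda>i x. x i m) (insert i {j})"
      by (rule indep_vars_subset[OF indep_coordinates]) simp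
    from indep_vars_sum[OF _ _ this] False
    have "indep_var borel (\<lambda>x. x i m) borel (\<lambda>x. x j m)" by simp
    from indep_var_integrable[OF this] indep_var_lebesgue_integral[OF this] False
    show ?thesis by (simp add: integrable_coordinate expectation_coordinate)
  qed
  then show "integrable M (\<lambda>x. x i m * x j m)"
    and "expectation (\<lambda>x. x i m * x j m) = (if i = j then 1 else 0)" by auto
qed

text \<open>Innovations of one component at distinct times are orthonormal, so this is Pythagoras.
  The injection g permits indexing by lag as well as by time.\<close>

lemma
  fixes b :: "'i \<Rightarrow> real"
  assumes I: "finite I" "inj_on g I"
  shows square_integrable_linear: "square_integrable M (\<lambda>x. \<Sum>i\<in>I. b i * x (g i) m)"
    and l2_norm_linear: "(l2_norm M (\<lambda>x. \<Sum>i\<in>I. b i * x (g i) m))\<^sup>2 = (\<Sum>i\<in>I. (b i)\<^sup>2)"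
proof -
  have eq: "(\<Sum>i\<in>I. b i * x (g i) m)\<^sup>2 = (\<Sum>i\<in>I. \<Sum>j\<in>I. b i * b j * (x (g i) m * x (g j) m))"
    for x :: "int \<Rightarrow> nat \<Rightarrow> real"
    by (simp add: power2_eq_square sum_product mult_ac)
  have "integrable M (\<lambda>x. (\<Sum>i\<in>I. b i * x (g i) m)\<^sup>2)"
    unfolding eq by (intro Bochner_Integration.integrable_sum integrable_mult_right integrable_coordinate_mult)
  then show "square_integrable M (\<lambda>x. \<Sum>i\<in>I. b i * x (g i) m)"
    by (simp add: square_integrable_def)
  have "(l2_norm M (\<lambda>x. \<Sum>i\<in>I. b i * x (g i) m))\<^sup>2
      = (\<Sum>i\<in>I. \<Sum>j\<in>I. b i * b j * (if g i = g j then 1 else 0))"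
    unfolding l2_norm_power2 eq
    by (simp add: integrable_coordinate_mult expectation_coordinate_mult)
  also have "\<dots> = (\<Sum>i\<in>I. \<Sum>j\<in>I. if i = j then b i * b j else 0)"
    using I by (intro sum.cong) (auto simp: inj_on_def)
  finally show "(l2_norm M (\<lambda>x. \<Sum>i\<in>I. b i * x (g i) m))\<^sup>2 = (\<Sum>i\<in>I. (b i)\<^sup>2)"
    using I by (simp add: power2_eq_square)
qed

lemma expectation_past_future_coordinate:
  assumes "A \<in> sets (past (Pi\<^sub>M UNIV \<nu>) i)" "i < j"
  shows "(\<integral>x. indicator A x * x j m \<partial>M) = 0"
proof -
  have "integrable (distr (Pi\<^sub>M UNIV \<nu>) borel (\<lambda>y. y m)) (\<lambda>y. y)"
    unfolding distr_alphabet_coordinate by (rule integrable_innovation)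
  then have int: "integrable (Pi\<^sub>M UNIV \<nu>) (\<lambda>y. y m)"
    by (subst (asm) integrable_distr_eq) auto
  have "(\<integral>y. y m \<partial>Pi\<^sub>M UNIV \<nu>) = (\<integral>y. y \<partial>distr (Pi\<^sub>M UNIV \<nu>) borel (\<lambda>y. y m))"
    by (subst integral_distr) auto
  then show ?thesis
    using integral_past_future[OF assms int]
    by (simp add: distr_alphabet_coordinate innovation_mean)
qed

text \<open>Centred independent normals add up to a normal variable, and \<open>l2_norm\<close> is
  its standard deviation; the law is therefore exact and no limit theorem enters.\<close>

lemma distr_linear_normal:
  assumes J: "finite J" and b: "\<And>s. s \<in> J \<Longrightarrow> 0 \<le> b s" and pos: "0 < (\<Sum>s\<in>J. (b s)\<^sup>2)"
    and \<nu>: "\<nu> m = std_normal_distribution"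
  shows "distr M borel (\<lambda>x. (\<Sum>s\<in>J. b s * x s m) / l2_norm M (\<lambda>x. \<Sum>s\<in>J. b s * x s m))
    = std_normal_distribution"
proof -
  \<comment> \<open>Zero coefficients are dropped, because the summation rule for normal densities
    asks for positive standard deviations.\<close>
  define K where "K = {s \<in> J. 0 < b s}"
  define \<tau> where "\<tau> = sqrt (\<Sum>s\<in>J. (b s)\<^sup>2)"
  have sumK: "(\<Sum>s\<in>J. b s * c s) = (\<Sum>s\<in>K. b s * c s)" for c :: "int \<Rightarrow> real"
    unfolding K_def using J b by (intro sum.mono_neutral_right) (auto simp: less_le)
  from sumK[of b] have K\<tau>: "\<tau> = sqrt (\<Sum>s\<in>K. (b s)\<^sup>2)" by (simp add: \<tau>_def power2_eq_square)
  have \<tau>: "\<tau> > 0" using pos by (simp add: \<tau>_def)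
  have K: "finite K" using J by (simp add: K_def)
  have "K \<noteq> {}" using K\<tau> \<tau> by auto
  have "distributed M lborel (\<lambda>x. \<Sum>s\<in>K. b s * x s m)
      (normal_density (\<Sum>s\<in>K. 0) (sqrt (\<Sum>s\<in>K. (b s)\<^sup>2)))"
  proof (rule sum_indep_normal[OF K \<open>K \<noteq> {}\<close>])
    have "indep_vars (\<lambda>_. borel) (\<lambda>s x. x s m) K"
      by (rule indep_vars_subset[OF indep_coordinates subset_UNIV])
    from indep_vars_compose2[OF this, of "\<lambda>s y. b s * y" "\<lambda>_. borel"]
    show "indep_vars (\<lambda>i. borel) (\<lambda>s x. b s * x s m) K" by simp
    fix s assume "s \<in> K"
    then show "0 < b s" by (simp add: K_def)
    have "distributed M lborel (\<lambda>x. x s m) std_normal_density"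
      unfolding distributed_def
    proof (intro conjI)
      have "distr M lborel (\<lambda>x. x s m) = distr M borel (\<lambda>x. x s m)" by (rule distr_cong) auto
      then show "distr M lborel (\<lambda>x. x s m) = density lborel (\<lambda>x. ennreal (std_normal_density x))"
        by (simp add: distr_coordinate \<nu>)
    qed auto
    from normal_density_affine[OF this, of "b s" 0] \<open>0 < b s\<close>
    show "distributed M lborel (\<lambda>x. b s * x s m) (normal_density 0 (b s))" by simp
  qed
  then have "distributed M lborel (\<lambda>x. \<Sum>s\<in>K. b s * x s m) (normal_density 0 \<tau>)"
    by (simp add: K\<tau>)
  from normal_density_affine[OF this \<tau>, of "1 / \<tau>" 0] \<tau>
  have "distributed M lborel (\<lambda>x. (\<Sum>s\<in>J. b s * x s m) / \<tau>) std_normal_density"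
    by (simp add: sumK)
  then have "distr M lborel (\<lambda>x. (\<Sum>s\<in>J. b s * x s m) / \<tau>) = std_normal_distribution"
    by (rule distributed_distr_eq_density)
  moreover have "l2_norm M (\<lambda>x. \<Sum>s\<in>J. b s * x s m) = \<tau>"
  proof (rule power2_eq_imp_eq)
    show "(l2_norm M (\<lambda>x. \<Sum>s\<in>J. b s * x s m))\<^sup>2 = \<tau>\<^sup>2"
      using l2_norm_linear[OF J inj_on_id2, of b m] by (simp add: \<tau>_def sum_nonneg)
  qed (use \<tau> in \<open>simp_all add: l2_norm_nonneg\<close>)
  moreover have "distr M lborel (\<lambda>x. (\<Sum>s\<in>J. b s * x s m) / \<tau>) = distr M borel (\<lambda>x. (\<Sum>s\<in>J. b s * x s m) / \<tau>)"
    by (rule distr_cong) auto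
  ultimately show ?thesis by (simp only:)
qed

text \<open>Union bound: a nonzero sum requires a nonzero innovation. It counts innovations and
  ignores their size, so it can be small although each has variance 1.\<close>

lemma prob_linear_nonzero_le:
  assumes "finite J"
  shows "prob {x \<in> space M. (\<Sum>s\<in>J. b s * x s m) \<noteq> 0} \<le> card J * measure (\<nu> m) {y. y \<noteq> 0}"
proof -
  have "prob {x \<in> space M. (\<Sum>s\<in>J. b s * x s m) \<noteq> 0} \<le> prob (\<Union>s\<in>J. {x \<in> space M. x s m \<noteq> 0})"
    using assms by (intro finite_measure_mono sets.finite_UN) (auto intro: ccontr sum.neutral)
  also have "\<dots> \<le> (\<Sum>s\<in>J. prob {x \<in> space M. x s m \<noteq> 0})"
    using assms by (intro measure_UNION_le) auto
  also have "\<dots> = (\<Sum>s\<in>J. measure (\<nu> m) {y. y \<noteq> 0})"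
  proof (rule sum.cong)
    fix s
    have "measure (distr M borel (\<lambda>x. x s m)) {y. y \<noteq> 0} = prob ((\<lambda>x. x s m) -` {y. y \<noteq> 0} \<inter> space M)"
      by (rule measure_distr) auto
    then show "prob {x \<in> space M. x s m \<noteq> 0} = measure (\<nu> m) {y. y \<noteq> 0}"
      unfolding distr_coordinate by (simp add: vimage_def Int_def conj_commute)
  qed simp
  finally show ?thesis by simp
qed

end

text \<open>\<open>window\<close> controls the part of a Birkhoff sum predictable at time 0: the
  window from i of length n collects the weights that the innovation at time -i receives. For n = 1
  it bounds the norm of the component itself by \<open>e m\<close>.\<close>

locale moving_average = innovation_family +
  fixes a :: "nat \<Rightarrow> nat \<Rightarrow> real" and N :: "nat \<Rightarrow> nat" and e :: "nat \<Rightarrow> real"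
  assumes coeff_nonneg: "\<And>m i. 0 \<le> a m i"
    and coeff_eq_0: "\<And>m i. N m \<le> i \<Longrightarrow> a m i = 0"
    and window: "\<And>m n K. 1 \<le> n \<Longrightarrow>
      (\<Sum>i<K. (\<Sum>l=i..<i+n. a m l)\<^sup>2) \<le> (e m)\<^sup>2 * real n / (1 + ln (real n))\<^sup>2"
    and e_nonneg: "\<And>m. 0 \<le> e m" and e_summable: "summable e"
begin

abbreviation past0 :: "(int \<Rightarrow> nat \<Rightarrow> real) measure" where
  "past0 \<equiv> past (Pi\<^sub>M UNIV \<nu>) 0"

definition component :: "nat \<Rightarrow> (int \<Rightarrow> nat \<Rightarrow> real) \<Rightarrow> real" where
  "component m x = (\<Sum>i<N m. a m i * x (- int i) m)"

definition f :: "(int \<Rightarrow> nat \<Rightarrow> real) \<Rightarrow> real" where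
  "f x = (\<Sum>m. component m x)"

text \<open>Weight of the innovation at time s in the n-th Birkhoff sum, summed over the lags t - s
  \<ge> 0 with 0 \<le> t < n. Truncation by \<open>nat\<close> is intended: it starts the lags at 0
  for s \<ge> 0 and empties the range for s \<ge> n.\<close>

definition coef :: "nat \<Rightarrow> nat \<Rightarrow> int \<Rightarrow> real" where
  "coef m n s = (\<Sum>l=nat (- s)..<nat (int n - s). a m l)"

definition total :: "nat \<Rightarrow> real" where
  "total m = (\<Sum>i<N m. a m i)"

section \<open>Birkhoff sums of one component\<close>

lemma coef_nonneg: "0 \<le> coef m n s"
  unfolding coef_def by (intro sum_nonneg coeff_nonneg)

lemma coef_le_total: "coef m n s \<le> total m"
proof -
  let ?I = "{nat (- s)..<nat (int n - s)}"
  have "coef m n s \<le> (\<Sum>l\<in>{..<N m} \<union> ?I. a m l)"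
    unfolding coef_def by (intro sum_mono2) (auto simp: coeff_nonneg)
  also have "\<dots> = total m"
    unfolding total_def by (intro sum.mono_neutral_right) (auto simp: coeff_eq_0)
  finally show ?thesis .
qed

lemma total_nonneg: "0 \<le> total m"
  unfolding total_def by (intro sum_nonneg coeff_nonneg)

lemma component_shift: "component m ((shift ^^ t) x) = (\<Sum>i<N m. a m i * x (int t - int i) m)"
  by (simp add: component_def shift_funpow)

lemma coef_Suc: "coef m (Suc n) s = coef m n s + (if s \<le> int n then a m (nat (int n - s)) else 0)"
proof (cases "s \<le> int n")
  case True
  then have "nat (int (Suc n) - s) = Suc (nat (int n - s))" "nat (- s) \<le> nat (int n - s)" by auto
  with True show ?thesis by (simp add: coef_def)
qed (auto simp: coef_def)

text \<open>The upper end b is left free so that the terms of a Birkhoff sum at all times can be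
  written over one index set. The test on s matters, since \<open>nat\<close> would turn a negative
  lag into lag 0.\<close>

lemma component_shift_eq_sum:
  assumes "int n < b"
  shows "component m ((shift ^^ n) x) =
    (\<Sum>s\<in>{- int (N m)..<b}. (if s \<le> int n then a m (nat (int n - s)) else 0) * x s m)"
proof -
  let ?g = "\<lambda>i. int n - int i"
  have "component m ((shift ^^ n) x) =
      (\<Sum>s\<in>?g ` {..<N m}. (if s \<le> int n then a m (nat (int n - s)) else 0) * x s m)"
    unfolding component_shift by (subst sum.reindex) (auto simp: inj_on_def)
  also have "\<dots> = (\<Sum>s\<in>{- int (N m)..<b}. (if s \<le> int n then a m (nat (int n - s)) else 0) * x s m)"
  proof (rule sum.mono_neutral_left)
    show "?g ` {..<N m} \<subseteq> {- int (N m)..<b}" using assms by auto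
    show "\<forall>s\<in>{- int (N m)..<b} - ?g ` {..<N m}.
        (if s \<le> int n then a m (nat (int n - s)) else 0) * x s m = 0"
    proof
      fix s assume s: "s \<in> {- int (N m)..<b} - ?g ` {..<N m}"
      have "N m \<le> nat (int n - s)" if "s \<le> int n"
      proof (rule ccontr)
        assume "\<not> N m \<le> nat (int n - s)"
        with that have "s \<in> ?g ` {..<N m}" by (intro image_eqI[where x = "nat (int n - s)"]) auto
        with s show False by simp
      qed
      then show "(if s \<le> int n then a m (nat (int n - s)) else 0) * x s m = 0"
        by (simp add: coeff_eq_0)
    qed
  qed simp
  finally show ?thesis .
qed

lemma birkhoff_component:
  "birkhoff_sum shift (component m) n x = (\<Sum>s\<in>{- int (N m)..<int n}. coef m n s * x s m)"
proof -
  have "birkhoff_sum shift (component m) n x = (\<Sum>s\<in>{- int (N m)..<b}. coef m n s * x s m)"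
    if "int n \<le> b" for b
    using that
  proof (induction n)
    case 0
    then show ?case by (simp add: birkhoff_sum_def coef_def)
  next
    case (Suc n)
    then have "birkhoff_sum shift (component m) (Suc n) x =
        (\<Sum>s\<in>{- int (N m)..<b}. coef m n s * x s m) + component m ((shift ^^ n) x)"
      by (simp add: birkhoff_sum_def)
    also have "component m ((shift ^^ n) x) =
        (\<Sum>s\<in>{- int (N m)..<b}. (if s \<le> int n then a m (nat (int n - s)) else 0) * x s m)"
      using Suc.prems by (intro component_shift_eq_sum) simp
    finally show ?case
      by (simp add: coef_Suc distrib_right sum.distrib)
  qed
  from this[OF order_refl] show ?thesis .
qed

lemma
  shows square_integrable_component_shift: "square_integrable M (\<lambda>x. component m ((shift ^^ t) x))"
    and l2_norm_component_shift: "l2_norm M (\<lambda>x. component m ((shift ^^ t) x)) \<le> e m"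
proof -
  have inj: "inj_on (\<lambda>i. int t - int i) {..<N m}" by (simp add: inj_on_def)
  show "square_integrable M (\<lambda>x. component m ((shift ^^ t) x))"
    unfolding component_shift by (rule square_integrable_linear[OF _ inj]) simp
  have "(l2_norm M (\<lambda>x. component m ((shift ^^ t) x)))\<^sup>2 = (\<Sum>i<N m. (a m i)\<^sup>2)"
    unfolding component_shift by (rule l2_norm_linear[OF _ inj]) simp
  \<comment> \<open>A window of length 1 holds one coefficient, and 1 + ln 1 = 1.\<close>
  also have "\<dots> \<le> (e m)\<^sup>2" using window[of 1 m "N m"] by simp
  finally show "l2_norm M (\<lambda>x. component m ((shift ^^ t) x)) \<le> e m"
    by (rule power2_le_imp_le) (rule e_nonneg)
qed

lemma
  shows square_integrable_birkhoff_component: "square_integrable M (birkhoff_sum shift (component m) n)"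
    and l2_norm_birkhoff_component_le: "l2_norm M (birkhoff_sum shift (component m) n) \<le> real n * e m"
proof -
  have eq: "birkhoff_sum shift (component m) n = (\<lambda>x. \<Sum>t<n. component m ((shift ^^ t) x))"
    by (simp add: birkhoff_sum_def fun_eq_iff)
  show "square_integrable M (birkhoff_sum shift (component m) n)"
    unfolding eq by (rule square_integrable_sum) (rule square_integrable_component_shift)
  have "l2_norm M (birkhoff_sum shift (component m) n) \<le> (\<Sum>t<n. l2_norm M (\<lambda>x. component m ((shift ^^ t) x)))"
    unfolding eq by (rule l2_norm_sum) (rule square_integrable_component_shift)
  also have "\<dots> \<le> (\<Sum>t<n. e m)" by (rule sum_mono) (rule l2_norm_component_shift)
  finally show "l2_norm M (birkhoff_sum shift (component m) n) \<le> real n * e m" by simp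
qed

lemma l2_norm_birkhoff_component:
  "(l2_norm M (birkhoff_sum shift (component m) n))\<^sup>2 = (\<Sum>s\<in>{- int (N m)..<int n}. (coef m n s)\<^sup>2)"
proof -
  have eq: "birkhoff_sum shift (component m) n = (\<lambda>x. \<Sum>s\<in>{- int (N m)..<int n}. coef m n s * x s m)"
    by (simp add: birkhoff_component fun_eq_iff)
  show ?thesis unfolding eq by (rule l2_norm_linear[OF _ inj_on_id2]) simp
qed

text \<open>Two upper bounds serve opposite regimes: \<open>real n * e m\<close> is small for
  components whose scale lies far beyond n, while the present one is sharp up to a constant once n
  \<ge> 2 * N m.\<close>

lemma l2_norm_birkhoff_component_upper:
  "l2_norm M (birkhoff_sum shift (component m) n) \<le> total m * sqrt (real (n + N m))"
proof (rule power2_le_imp_le)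
  have "(l2_norm M (birkhoff_sum shift (component m) n))\<^sup>2 \<le> (\<Sum>s\<in>{- int (N m)..<int n}. (total m)\<^sup>2)"
    unfolding l2_norm_birkhoff_component by (intro sum_mono power_mono coef_le_total coef_nonneg)
  also have "\<dots> = (total m * sqrt (real (n + N m)))\<^sup>2"
    by (simp add: power_mult_distrib nat_add_distrib)
  finally show "(l2_norm M (birkhoff_sum shift (component m) n))\<^sup>2 \<le> (total m * sqrt (real (n + N m)))\<^sup>2" .
qed (simp add: total_nonneg)

text \<open>Innovations at times 1 to n - N m have passed through the whole filter and carry the
  full weight \<open>total m\<close>; the others can only increase the sum of squares.\<close>

lemma l2_norm_birkhoff_component_lower:
  assumes "N m \<le> n"
  shows "total m * sqrt (real (n - N m)) \<le> l2_norm M (birkhoff_sum shift (component m) n)"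
proof (rule power2_le_imp_le)
  have "(total m * sqrt (real (n - N m)))\<^sup>2 = (\<Sum>s\<in>{1..int (n - N m)}. (total m)\<^sup>2)"
    by (simp add: power_mult_distrib)
  also have "\<dots> = (\<Sum>s\<in>{1..int (n - N m)}. (coef m n s)\<^sup>2)"
  proof (rule sum.cong)
    fix s assume s: "s \<in> {1..int (n - N m)}"
    then have "coef m n s = (\<Sum>l<nat (int n - s). a m l)"
      by (simp add: coef_def atLeast0LessThan)
    also have "\<dots> = total m"
      unfolding total_def using s assms by (intro sum.mono_neutral_right) (auto simp: coeff_eq_0)
    finally show "(total m)\<^sup>2 = (coef m n s)\<^sup>2" by simp
  qed simp
  \<comment> \<open>The range is enlarged to n itself, because n - N m equals n when N m = 0; the
    weight at time n is an empty sum.\<close>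
  also have "\<dots> \<le> (\<Sum>s\<in>{- int (N m)..int n}. (coef m n s)\<^sup>2)"
    by (intro sum_mono2) auto
  also have "{- int (N m)..int n} = insert (int n) {- int (N m)..<int n}" by auto
  also have "(\<Sum>s\<in>insert (int n) {- int (N m)..<int n}. (coef m n s)\<^sup>2) =
      (\<Sum>s\<in>{- int (N m)..<int n}. (coef m n s)\<^sup>2)"
    by (simp add: coef_def)
  finally show "(total m * sqrt (real (n - N m)))\<^sup>2 \<le> (l2_norm M (birkhoff_sum shift (component m) n))\<^sup>2"
    by (simp add: l2_norm_birkhoff_component)
qed (rule l2_norm_nonneg)

section \<open>Birkhoff sums of the superposition\<close>

lemma summable_scaled: "summable (\<lambda>m. real n * e m)"
  by (intro summable_mult e_summable)

text \<open>The null sets belonging to the countably many times are united; outside them a finite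
  sum over time commutes with the series over components.\<close>

lemma AE_birkhoff_f:
  "AE x in M. summable (\<lambda>m. \<bar>birkhoff_sum shift (component m) n x\<bar>) \<and>
    birkhoff_sum shift f n x = (\<Sum>m. birkhoff_sum shift (component m) n x)"
proof -
  have "AE x in M. summable (\<lambda>m. \<bar>component m ((shift ^^ t) x)\<bar>)" for t
    by (rule AE_summable_of_l2[OF square_integrable_component_shift l2_norm_component_shift e_summable])
  then have 1: "AE x in M. \<forall>t. summable (\<lambda>m. \<bar>component m ((shift ^^ t) x)\<bar>)"
    by (simp add: AE_all_countable)
  have 2: "AE x in M. summable (\<lambda>m. \<bar>birkhoff_sum shift (component m) n x\<bar>)"
    by (rule AE_summable_of_l2[OF square_integrable_birkhoff_component l2_norm_birkhoff_component_le summable_scaled])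
  from 1 2 show ?thesis
  proof eventually_elim
    case (elim x)
    then have "summable (\<lambda>m. component m ((shift ^^ t) x))" for t
      by (blast intro: summable_rabs_cancel)
    then have "(\<Sum>t<n. \<Sum>m. component m ((shift ^^ t) x)) = (\<Sum>m. \<Sum>t<n. component m ((shift ^^ t) x))"
      by (intro suminf_sum[symmetric])
    with elim show ?case by (simp add: birkhoff_sum_def f_def)
  qed
qed

lemma series_component_measurable_past: "component m \<in> borel_measurable past0"
proof -
  have "(\<lambda>x. x (- int i) m) \<in> borel_measurable past0" for i
    by (rule measurable_compose[OF component_measurable_past alphabet_coordinate_measurable]) simp
  then show ?thesis
    unfolding component_def[abs_def] by (intro borel_measurable_sum borel_measurable_times) simp_all
qed

lemma f_measurable_past: "f \<in> borel_measurable past0"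
  unfolding f_def[abs_def] by (rule borel_measurable_suminf) (rule series_component_measurable_past)

lemma f_measurable: "f \<in> borel_measurable M"
  using measurable_from_subalg[OF subalgebra_past f_measurable_past] .

lemma birkhoff_f_measurable: "birkhoff_sum shift f n \<in> borel_measurable M"
  unfolding birkhoff_sum_def[abs_def]
  by (intro borel_measurable_sum measurable_compose[OF shift_funpow_measurable f_measurable])

lemma square_integrable_birkhoff_f: "square_integrable M (birkhoff_sum shift f n)"
proof (rule square_integrable_cong_AE)
  show "square_integrable M (\<lambda>x. \<Sum>m. birkhoff_sum shift (component m) n x)"
    by (rule square_integrable_suminf[OF square_integrable_birkhoff_component l2_norm_birkhoff_component_le summable_scaled])
  show "AE x in M. (\<Sum>m. birkhoff_sum shift (component m) n x) = birkhoff_sum shift f n x"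
    using AE_birkhoff_f[of n] by eventually_elim simp
qed (rule birkhoff_f_measurable)

lemma square_integrable_f: "square_integrable M f"
  using square_integrable_birkhoff_f[of 1] by (simp add: birkhoff_sum_def[abs_def])

section \<open>The conditional expectation given the past\<close>

definition past_part :: "nat \<Rightarrow> nat \<Rightarrow> (int \<Rightarrow> nat \<Rightarrow> real) \<Rightarrow> real" where
  "past_part m n x = (\<Sum>s\<in>{- int (N m)..0}. coef m n s * x s m)"

lemma
  shows square_integrable_past_part: "square_integrable M (past_part m n)"
    and l2_norm_past_part: "(l2_norm M (past_part m n))\<^sup>2 = (\<Sum>s\<in>{- int (N m)..0}. (coef m n s)\<^sup>2)"
  unfolding past_part_def[abs_def]
  by (rule square_integrable_linear[OF _ inj_on_id2] l2_norm_linear[OF _ inj_on_id2], simp)+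

text \<open>With s = -i the weights are the window sums starting at i, so \<open>window\<close> with
  K = N m + 1 is the claim squared.\<close>

lemma l2_norm_past_part_le:
  assumes "n \<ge> 1"
  shows "l2_norm M (past_part m n) \<le> e m * (sqrt (real n) / (1 + ln (real n)))"
proof (rule power2_le_imp_le)
  have "(l2_norm M (past_part m n))\<^sup>2 = (\<Sum>i<Suc (N m). (coef m n (- int i))\<^sup>2)"
    unfolding l2_norm_past_part
    by (rule sum.reindex_bij_witness[where i = "\<lambda>i. - int i" and j = "\<lambda>s. nat (- s)"]) auto
  also have "\<dots> = (\<Sum>i<Suc (N m). (\<Sum>l=i..<i+n. a m l)\<^sup>2)"
    by (intro sum.cong refl) (simp add: coef_def nat_add_distrib add.commute)
  also have "\<dots> \<le> (e m)\<^sup>2 * real n / (1 + ln (real n))\<^sup>2" by (rule window[OF assms])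
  also have "\<dots> = (e m * (sqrt (real n) / (1 + ln (real n))))\<^sup>2"
    by (simp add: power_mult_distrib power_divide)
  finally show "(l2_norm M (past_part m n))\<^sup>2 \<le> (e m * (sqrt (real n) / (1 + ln (real n))))\<^sup>2" .
  show "0 \<le> e m * (sqrt (real n) / (1 + ln (real n)))"
    using assms by (intro mult_nonneg_nonneg divide_nonneg_nonneg e_nonneg add_nonneg_nonneg) auto
qed

text \<open>At most N m + 1 innovations up to time 0 still act, each with weight at most
  \<open>total m\<close>. The bound is free of n, which is what turns a uniform O into an o,
  component by component.\<close>

lemma l2_norm_past_part_bounded: "l2_norm M (past_part m n) \<le> total m * sqrt (real (Suc (N m)))"
proof (rule power2_le_imp_le)
  have "(l2_norm M (past_part m n))\<^sup>2 \<le> (\<Sum>s\<in>{- int (N m)..0}. (total m)\<^sup>2)"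
    unfolding l2_norm_past_part by (intro sum_mono power_mono coef_le_total coef_nonneg)
  also have "\<dots> = (total m * sqrt (real (Suc (N m))))\<^sup>2"
    by (simp add: power_mult_distrib)
  finally show "(l2_norm M (past_part m n))\<^sup>2 \<le> (total m * sqrt (real (Suc (N m))))\<^sup>2" .
qed (simp add: total_nonneg)

lemma past_part_measurable: "past_part m n \<in> borel_measurable past0"
  unfolding past_part_def[abs_def]
  by (intro borel_measurable_sum borel_measurable_times borel_measurable_const
      measurable_compose[OF component_measurable_past alphabet_coordinate_measurable]) simp

lemma l2_norm_past_part_le_scaled:
  "l2_norm M (past_part m n) \<le> (sqrt (real n) / (1 + ln (real n)) + real n) * e m"
proof (cases "n = 0")
  case True
  have "l2_norm M (past_part m n) = 0"
    using l2_norm_past_part[of m n] by (simp add: coef_def True)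
  then show ?thesis by (simp add: True)
next
  case False
  then have "l2_norm M (past_part m n) \<le> e m * (sqrt (real n) / (1 + ln (real n)))"
    by (intro l2_norm_past_part_le) simp
  moreover have "0 \<le> real n * e m" by (simp add: e_nonneg)
  ultimately show ?thesis by (simp add: algebra_simps)
qed

text \<open>The Birkhoff sum exceeds its past part by innovations at times 1 to n - 1, which
  integrate to 0 over every event of \<open>past0\<close>; hence \<open>past_part\<close> is the
  conditional expectation of the component's sum.\<close>

lemma integral_past_part:
  assumes "n \<ge> 1" and A: "A \<in> sets past0"
  shows "(\<integral>x. indicator A x * birkhoff_sum shift (component m) n x \<partial>M) = (\<integral>x. indicator A x * past_part m n x \<partial>M)"
proof -
  have AM: "A \<in> sets M" using A subalgebra_past by (auto simp: subalgebra_def)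
  let ?h = "\<lambda>x. \<Sum>s\<in>{1..<int n}. coef m n s * x s m"
  have eq: "birkhoff_sum shift (component m) n x = past_part m n x + ?h x" for x
  proof -
    have "{- int (N m)..<int n} = {- int (N m)..0} \<union> {1..<int n}" using assms by auto
    then show ?thesis
      unfolding birkhoff_component past_part_def by (simp only:) (rule sum.union_disjoint, auto)
  qed
  have int: "integrable M (\<lambda>x. indicator A x * x s m)" for s
    using integrable_mult_indicator[OF AM integrable_coordinate[of s m]] by simp
  have "(\<integral>x. indicator A x * ?h x \<partial>M) = (\<integral>x. (\<Sum>s\<in>{1..<int n}. coef m n s * (indicator A x * x s m)) \<partial>M)"
    by (simp add: sum_distrib_left mult_ac)
  also have "\<dots> = (\<Sum>s\<in>{1..<int n}. coef m n s * (\<integral>x. indicator A x * x s m \<partial>M))"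
    by (simp add: int)
  also have "\<dots> = 0"
    by (intro sum.neutral ballI) (simp add: expectation_past_future_coordinate[OF A])
  finally have h: "(\<integral>x. indicator A x * ?h x \<partial>M) = 0" .
  have int1: "integrable M (\<lambda>x. indicator A x * past_part m n x)"
    using integrable_mult_indicator[OF AM integrable_of_square_integrable[OF square_integrable_past_part[of m n]]]
    by simp
  have "square_integrable M ?h" by (rule square_integrable_linear[OF _ inj_on_id2]) simp
  from integrable_mult_indicator[OF AM integrable_of_square_integrable[OF this]]
  have int2: "integrable M (\<lambda>x. indicator A x * ?h x)" by simp
  show ?thesis
    unfolding eq distrib_left Bochner_Integration.integral_add[OF int1 int2] h by simp
qed

text \<open>Conditional expectation passes through the series: for each event of
  \<open>past0\<close> both series are exchanged with the integral, and the integrals agree term by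
  term.\<close>

lemma AE_cond_exp_birkhoff:
  assumes "n \<ge> 1"
  shows "AE x in M. real_cond_exp M past0 (birkhoff_sum shift f n) x = (\<Sum>m. past_part m n x)"
proof -
  interpret sigma_finite_subalgebra M past0
    by (rule finite_measure_subalgebra_is_sigma_finite)
       (simp add: finite_measure_subalgebra_def finite_measure_subalgebra_axioms_def
          finite_measure_axioms subalgebra_past)
  have sum1: "summable (\<lambda>m. (sqrt (real n) / (1 + ln (real n)) + real n) * e m)"
    by (intro summable_mult e_summable)
  note sq = square_integrable_suminf[OF square_integrable_past_part l2_norm_past_part_le_scaled sum1]
  show ?thesis
  proof (rule real_cond_exp_charact)
    show "integrable M (birkhoff_sum shift f n)"
      by (rule integrable_of_square_integrable[OF square_integrable_birkhoff_f])
    show "integrable M (\<lambda>x. \<Sum>m. past_part m n x)"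
      by (rule integrable_of_square_integrable[OF sq])
    show "(\<lambda>x. \<Sum>m. past_part m n x) \<in> borel_measurable past0"
      by (rule borel_measurable_suminf) (rule past_part_measurable)
    fix A assume A: "A \<in> sets past0"
    have AM[measurable]: "A \<in> sets M" using A subalgebra_past by (auto simp: subalgebra_def)
    have "(\<integral>x. indicator A x * birkhoff_sum shift f n x \<partial>M) =
        (\<integral>x. indicator A x * (\<Sum>m. birkhoff_sum shift (component m) n x) \<partial>M)"
    proof (rule integral_cong_AE)
      show "AE x in M. indicator A x * birkhoff_sum shift f n x =
          indicator A x * (\<Sum>m. birkhoff_sum shift (component m) n x)"
        using AE_birkhoff_f[of n] by eventually_elim simp
      have ms: "(\<lambda>x. \<Sum>m. birkhoff_sum shift (component m) n x) \<in> borel_measurable M"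
        using square_integrable_birkhoff_component by (intro borel_measurable_suminf) (simp add: square_integrable_def)
      show "(\<lambda>x. indicator A x * birkhoff_sum shift f n x) \<in> borel_measurable M"
        by (intro borel_measurable_times birkhoff_f_measurable borel_measurable_indicator AM)
      show "(\<lambda>x. indicator A x * (\<Sum>m. birkhoff_sum shift (component m) n x)) \<in> borel_measurable M"
        by (intro borel_measurable_times ms borel_measurable_indicator AM)
    qed
    also have "\<dots> = (\<Sum>m. \<integral>x. indicator A x * birkhoff_sum shift (component m) n x \<partial>M)"
      by (rule integral_suminf_l2[OF square_integrable_birkhoff_component l2_norm_birkhoff_component_le summable_scaled AM])
    also have "\<dots> = (\<Sum>m. \<integral>x. indicator A x * past_part m n x \<partial>M)"
      by (simp only: integral_past_part[OF assms A])
    also have "\<dots> = (\<integral>x. indicator A x * (\<Sum>m. past_part m n x) \<partial>M)"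
      by (rule integral_suminf_l2[OF square_integrable_past_part l2_norm_past_part_le_scaled sum1 AM, symmetric])
    finally show "(LINT x:A|M. birkhoff_sum shift f n x) = (LINT x:A|M. \<Sum>m. past_part m n x)"
      by (simp add: set_lebesgue_integral_def)
  qed
qed

lemma summable_l2_norm_past_part: "summable (\<lambda>m. l2_norm M (past_part m n))"
proof (rule summable_comparison_test'[where N = 0])
  show "summable (\<lambda>m. (sqrt (real n) / (1 + ln (real n)) + real n) * e m)"
    by (intro summable_mult e_summable)
  show "norm (l2_norm M (past_part m n)) \<le> (sqrt (real n) / (1 + ln (real n)) + real n) * e m" for m
    using l2_norm_past_part_le_scaled[of m n] by (simp add: l2_norm_nonneg)
qed

lemma l2_norm_cond_exp_le:
  assumes "n \<ge> 1"
  shows "l2_norm M (real_cond_exp M past0 (birkhoff_sum shift f n)) \<le> (\<Sum>m. l2_norm M (past_part m n))"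
proof -
  have "l2_norm M (real_cond_exp M past0 (birkhoff_sum shift f n)) = l2_norm M (\<lambda>x. \<Sum>m. past_part m n x)"
  proof (rule l2_norm_cong_AE[OF _ _ AE_cond_exp_birkhoff[OF assms]])
    show "(\<lambda>x. \<Sum>m. past_part m n x) \<in> borel_measurable M"
      using square_integrable_past_part by (intro borel_measurable_suminf) (simp add: square_integrable_def)
    show "real_cond_exp M past0 (birkhoff_sum shift f n) \<in> borel_measurable M"
      by (rule borel_measurable_cond_exp2)
  qed
  also have "\<dots> \<le> (\<Sum>m. l2_norm M (past_part m n))"
    by (rule l2_norm_suminf[OF square_integrable_past_part order_refl summable_l2_norm_past_part])
  finally show ?thesis .
qed

text \<open>Each component contributes a bounded amount, and at most \<open>e m\<close> after normalisation,
  so dominated convergence for series applies.\<close>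

lemma cond_exp_smallo:
  "(\<lambda>n. l2_norm M (real_cond_exp M past0 (birkhoff_sum shift f n))) \<in> o(\<lambda>n. sqrt (real n) / ln (real n))"
proof (rule smalloI_tendsto)
  let ?w = "\<lambda>n. (1 + ln (real n)) / sqrt (real n)"
  let ?E = "\<lambda>n. l2_norm M (real_cond_exp M past0 (birkhoff_sum shift f n))"
  have w0: "0 \<le> ?w n" for n
    by (cases "n = 0") (auto intro!: divide_nonneg_nonneg add_nonneg_nonneg)
  have bound: "norm (?w n * l2_norm M (past_part m n)) \<le> e m" for m n
  proof (cases "n = 0")
    case False
    then have "?w n * l2_norm M (past_part m n) \<le> ?w n * (e m * (sqrt (real n) / (1 + ln (real n))))"
      by (intro mult_left_mono w0 l2_norm_past_part_le) simp
    also have "\<dots> = e m"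
    proof -
      have "0 < 1 + ln (real n)" using False by (intro add_pos_nonneg) auto
      with False show ?thesis by simp
    qed
    finally show ?thesis
      using mult_nonneg_nonneg[OF w0[of n] l2_norm_nonneg[of M "past_part m n"]] by simp
  qed (simp add: e_nonneg)
  have "(\<lambda>n. \<Sum>m. ?w n * l2_norm M (past_part m n)) \<longlonglongrightarrow> (\<Sum>m::nat. 0)"
  proof (rule tannerys_theorem[THEN conjunct2, THEN conjunct2])
    show "eventually (\<lambda>(m, n). norm (?w n * l2_norm M (past_part m n)) \<le> e m) (at_top \<times>\<^sub>F sequentially)"
      using bound by (intro always_eventually) auto
    show "(\<lambda>n. ?w n * l2_norm M (past_part m n)) \<longlonglongrightarrow> 0" for m
    proof (rule tendsto_sandwich[OF always_eventually always_eventually])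
      show "\<forall>n. 0 \<le> ?w n * l2_norm M (past_part m n)"
        by (intro allI mult_nonneg_nonneg w0 l2_norm_nonneg)
      show "\<forall>n. ?w n * l2_norm M (past_part m n) \<le> ?w n * (total m * sqrt (real (Suc (N m))))"
        by (intro allI mult_left_mono w0 l2_norm_past_part_bounded)
      have "?w \<longlonglongrightarrow> 0" by real_asymp
      then show "(\<lambda>n. ?w n * (total m * sqrt (real (Suc (N m))))) \<longlonglongrightarrow> 0"
        by (rule tendsto_mult_left_zero)
    qed simp
  qed (simp_all add: e_summable)
  then have lim: "(\<lambda>n. \<Sum>m. ?w n * l2_norm M (past_part m n)) \<longlonglongrightarrow> 0" by simp
  \<comment> \<open>From n = 2 on, ln n is positive and below 1 + ln n, so \<open>?w\<close>
    dominates the weight of the claim.\<close>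
  have ev: "eventually (\<lambda>n. norm (?E n / (sqrt (real n) / ln (real n)))
      \<le> (\<Sum>m. ?w n * l2_norm M (past_part m n))) sequentially"
    using eventually_ge_at_top[of 2]
  proof eventually_elim
    case (elim n)

    have "(\<Sum>m. ?w n * l2_norm M (past_part m n)) = ?w n * (\<Sum>m. l2_norm M (past_part m n))"
      by (rule suminf_mult[OF summable_l2_norm_past_part])
    moreover have "?w n * ?E n \<le> ?w n * (\<Sum>m. l2_norm M (past_part m n))"
      using elim by (intro mult_left_mono w0 l2_norm_cond_exp_le) simp
    moreover have "norm (?E n / (sqrt (real n) / ln (real n))) \<le> ?w n * ?E n"
    proof -
      have "norm (?E n / (sqrt (real n) / ln (real n))) = ln (real n) / sqrt (real n) * ?E n"
        using elim l2_norm_nonneg[of M] by (simp add: abs_mult)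
      also have "\<dots> \<le> ?w n * ?E n"
        by (intro mult_right_mono divide_right_mono l2_norm_nonneg) auto
      finally show ?thesis .
    qed
    ultimately show ?case by linarith
  qed
  show "(\<lambda>n. ?E n / (sqrt (real n) / ln (real n))) \<longlonglongrightarrow> 0"
    by (rule Lim_null_comparison[OF ev lim])
  show "eventually (\<lambda>n. sqrt (real n) / ln (real n) \<noteq> 0) sequentially"
    using eventually_ge_at_top[of 2] by eventually_elim simp
qed

lemma expectation_f: "expectation f = 0"
proof -
  have exp_component: "(\<integral>x. indicator (space M) x * component m x \<partial>M) = 0" for m
  proof -
    have "(\<integral>x. indicator (space M) x * component m x \<partial>M) = expectation (component m)"
      by (intro Bochner_Integration.integral_cong) auto
    also have "\<dots> = 0"
      unfolding component_def[abs_def] by (simp add: integrable_coordinate expectation_coordinate)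
    finally show ?thesis .
  qed
  have "expectation f = (\<integral>x. indicator (space M) x * (\<Sum>m. component m x) \<partial>M)"
    by (intro Bochner_Integration.integral_cong) (auto simp: f_def)
  also have "\<dots> = (\<Sum>m. \<integral>x. indicator (space M) x * component m x \<partial>M)"
    using integral_suminf_l2[OF square_integrable_component_shift[of _ 0] l2_norm_component_shift[of _ 0] e_summable sets.top]
    by simp
  finally show ?thesis by (simp add: exp_component)
qed

text \<open>Components before m are measured by their totals, those after m by the tail of e: when n
  is the m-th scale, the former have reached full variance and the latter are still negligible.
  Entry m is set to 0, so that the series lemmas apply unchanged.\<close>

lemma l2_norm_rest:
  shows "square_integrable M (\<lambda>x. birkhoff_sum shift f n x - birkhoff_sum shift (component m) n x)"
    and "l2_norm M (\<lambda>x. birkhoff_sum shift f n x - birkhoff_sum shift (component m) n x)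
      \<le> (\<Sum>k<m. total k * sqrt (real (n + N k))) + real n * (\<Sum>k. e (k + Suc m))"
proof -
  define h where "h k = (\<lambda>x. if k = m then 0 else birkhoff_sum shift (component k) n x)" for k
  define r where "r k = (if k < m then total k * sqrt (real (n + N k)) else if k = m then 0 else real n * e k)" for k
  have sq: "square_integrable M (h k)" for k
    using square_integrable_birkhoff_component[of k n] by (cases "k = m") (simp_all add: h_def square_integrable_def)
  have le: "l2_norm M (h k) \<le> r k" for k
    using l2_norm_birkhoff_component_upper[of k n] l2_norm_birkhoff_component_le[of k n]
    by (cases "k = m") (auto simp: h_def r_def l2_norm_def)
  have r_shift: "r (k + Suc m) = real n * e (k + Suc m)" for k by (simp add: r_def)
  have e_shift: "summable (\<lambda>k. e (k + Suc m))" using e_summable by (rule summable_ignore_initial_segment)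
  have "summable (\<lambda>k. r (k + Suc m))" unfolding r_shift by (intro summable_mult e_shift)
  then have r: "summable r" by (rule summable_iff_shift[THEN iffD1])
  have AE: "AE x in M. (\<Sum>k. h k x) = birkhoff_sum shift f n x - birkhoff_sum shift (component m) n x"
    using AE_birkhoff_f[of n]
  proof eventually_elim
    case (elim x)
    then have "(\<lambda>k. birkhoff_sum shift (component k) n x) sums birkhoff_sum shift f n x"
      by (auto simp: sums_iff intro: summable_rabs_cancel)
    from sums_diff[OF this sums_single[of m "\<lambda>k. birkhoff_sum shift (component k) n x"]]
    have "(\<lambda>k. h k x) sums (birkhoff_sum shift f n x - birkhoff_sum shift (component m) n x)"
      by (rule sums_cong[THEN iffD1, rotated]) (simp add: h_def)
    then show ?case by (rule sums_unique[symmetric])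
  qed
  have meas: "(\<lambda>x. birkhoff_sum shift f n x - birkhoff_sum shift (component m) n x) \<in> borel_measurable M"
    using square_integrable_birkhoff_component[of m n] birkhoff_f_measurable[of n]
    by (intro borel_measurable_diff) (simp_all add: square_integrable_def)
  show "square_integrable M (\<lambda>x. birkhoff_sum shift f n x - birkhoff_sum shift (component m) n x)"
    by (rule square_integrable_cong_AE[OF square_integrable_suminf[OF sq le r] meas AE])
  have "l2_norm M (\<lambda>x. birkhoff_sum shift f n x - birkhoff_sum shift (component m) n x) = l2_norm M (\<lambda>x. \<Sum>k. h k x)"
    using square_integrable_suminf[OF sq le r]
    by (intro l2_norm_cong_AE[symmetric] meas AE) (simp add: square_integrable_def)
  also have "\<dots> \<le> (\<Sum>k. r k)" by (rule l2_norm_suminf[OF sq le r])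
  also have "\<dots> = (\<Sum>k. r (k + Suc m)) + (\<Sum>k<Suc m. r k)" by (rule suminf_split_initial_segment[OF r])
  also have "(\<Sum>k. r (k + Suc m)) = real n * (\<Sum>k. e (k + Suc m))"
    unfolding r_shift by (rule suminf_mult[OF e_shift])
  also have "(\<Sum>k<Suc m. r k) = (\<Sum>k<m. total k * sqrt (real (n + N k)))"
    by (simp add: r_def)
  finally show "l2_norm M (\<lambda>x. birkhoff_sum shift f n x - birkhoff_sum shift (component m) n x)
      \<le> (\<Sum>k<m. total k * sqrt (real (n + N k))) + real n * (\<Sum>k. e (k + Suc m))"
    by simp
qed

end

section \<open>Dominating scales\<close>

text \<open>The law takes the values h and -h with probability 1/K each and 0 otherwise; h^2 = K/2
  makes the variance 1. It is realised as an image of the uniform law on K points.\<close>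

lemma ex_rare_innovation:
  assumes "(p::real) > 0"
  shows "\<exists>\<mu>. prob_space \<mu> \<and> sets \<mu> = sets borel \<and> integrable \<mu> (\<lambda>y. y\<^sup>2) \<and>
    (\<integral>y. y \<partial>\<mu>) = 0 \<and> (\<integral>y. y\<^sup>2 \<partial>\<mu>) = (1::real) \<and> measure \<mu> {y. y \<noteq> 0} \<le> p"
proof -
  obtain k :: nat where k: "2 / p \<le> real k" using real_arch_simple by blast
  \<comment> \<open>Two points are needed for the values h and -h; K \<ge> 2/p makes 2/K at most
    p.\<close>
  define K where "K = Suc (Suc k)"
  define U where "U = pmf_of_set {..<K}"
  define h where "h = sqrt (real K / 2)"
  define g :: "nat \<Rightarrow> real" where "g i = (if i = 0 then h else if i = 1 then - h else 0)" for i
  define \<mu> where "\<mu> = distr (measure_pmf U) borel g"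
  have K: "{..<K} \<noteq> {}" "finite {..<K}" by (auto simp: K_def)
  have U: "(\<integral>i. \<phi> (g i) \<partial>measure_pmf U) = (\<phi> h + \<phi> (- h)) / real K" if "\<phi> 0 = 0" for \<phi> :: "real \<Rightarrow> real"
  proof -
    have "(\<integral>i. \<phi> (g i) \<partial>measure_pmf U) = (\<Sum>i<K. \<phi> (g i)) / real K"
      unfolding U_def by (subst integral_pmf_of_set[OF K]) simp
    also have "(\<Sum>i<K. \<phi> (g i)) = (\<Sum>i\<in>{0, 1}. \<phi> (g i))"
      using that by (intro sum.mono_neutral_right) (auto simp: K_def g_def)
    finally show ?thesis by (simp add: g_def)
  qed
  have "prob_space \<mu>" unfolding \<mu>_def by (rule measure_pmf.prob_space_distr) simp
  moreover have "sets \<mu> = sets borel" by (simp add: \<mu>_def)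
  moreover have "integrable \<mu> (\<lambda>y. y\<^sup>2)"
    unfolding \<mu>_def by (subst integrable_distr_eq)
      (auto intro: integrable_measure_pmf_finite simp: U_def set_pmf_of_set[OF K])
  moreover have "(\<integral>y. y \<partial>\<mu>) = 0"
    unfolding \<mu>_def using U[of "\<lambda>y. y"] by (subst integral_distr) auto
  moreover have "(\<integral>y. y\<^sup>2 \<partial>\<mu>) = 1"
    unfolding \<mu>_def using U[of "\<lambda>y. y\<^sup>2"] by (subst integral_distr) (auto simp: h_def K_def)
  moreover have "measure \<mu> {y. y \<noteq> 0} \<le> p"
  proof -
    have "measure \<mu> {y. y \<noteq> 0} = measure (measure_pmf U) {i. g i \<noteq> 0}"
      unfolding \<mu>_def by (subst measure_distr) (auto simp: vimage_def)
    also have "\<dots> \<le> measure (measure_pmf U) {0, 1}"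
      by (intro measure_pmf.finite_measure_mono) (auto simp: g_def)
    also have "\<dots> = 2 / real K"
    proof -
      have "{..<K} \<inter> {0, 1} = {0, 1}" by (auto simp: K_def)
      then show ?thesis unfolding U_def by (subst measure_pmf_of_set[OF K]) simp
    qed
    also have "\<dots> \<le> p"
    proof -
      have "2 / p \<le> real K" using k by (simp add: K_def)
      then show ?thesis using assms by (simp add: K_def field_simps)
    qed
    finally show ?thesis .
  qed
  ultimately show ?thesis by blast
qed

lemma sum_mult_fact: "(\<Sum>k<m. real k * fact k) = fact m - 1"
  by (induction m) (simp_all add: algebra_simps)

text \<open>\<open>N_le\<close> makes at least n m / 2 innovations carry full weight at time n m,
  and \<open>tail\<close> lets all later components together contribute at most 1. In
  \<open>rare_innovation\<close>, 2 * n m bounds the number n m + N m of innovations in the m-th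
  sum.\<close>

locale dominating_scales = moving_average +
  fixes n :: "nat \<Rightarrow> nat"
  assumes coeff_sum: "\<And>m. (\<Sum>i<N m. a m i) = real m * fact m"
    and n_strict_mono: "strict_mono n" and n_pos: "\<And>m. 1 \<le> n m"
    and N_le: "\<And>m. 2 * N m \<le> n m"
    and tail: "\<And>m. real (n m) * (\<Sum>k. e (k + Suc m)) \<le> 1"
    and normal_innovation: "\<And>m. even m \<Longrightarrow> \<nu> m = std_normal_distribution"
    and rare_innovation: "\<And>m. odd m \<Longrightarrow> real (2 * n m) * measure (\<nu> m) {y. y \<noteq> 0} \<le> 1 / real m"
begin

section \<open>Dominance of component m at time n m\<close>

abbreviation main :: "nat \<Rightarrow> (int \<Rightarrow> nat \<Rightarrow> real) \<Rightarrow> real" where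
  "main m \<equiv> birkhoff_sum shift (component m) (n m)"

lemma total_eq: "total m = real m * fact m"
  by (simp add: total_def coeff_sum)

lemma main_lower:
  "real m * fact m * sqrt (real (n m) / 2) \<le> l2_norm M (main m)"
proof -
  have "real (n m) / 2 \<le> real (n m - N m)" using N_le[of m] by linarith
  then have "real m * fact m * sqrt (real (n m) / 2) \<le> total m * sqrt (real (n m - N m))"
    unfolding total_eq by (intro mult_left_mono) auto
  also have "\<dots> \<le> l2_norm M (main m)"
    using N_le[of m] by (intro l2_norm_birkhoff_component_lower) simp
  finally show ?thesis .
qed

lemma main_pos:
  assumes "m \<ge> 1"
  shows "0 < l2_norm M (main m)"
proof -
  have "0 < real m * fact m * sqrt (real (n m) / 2)" using assms n_pos[of m] by simp
  then show ?thesis using main_lower[of m] by linarith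
qed

text \<open>The ratio 2/m compares m! sqrt (2 n) for the remainder with m * m! sqrt (n/2) for the
  main term.\<close>

lemma rest_le:
  assumes "m \<ge> 1"
  shows "l2_norm M (\<lambda>x. birkhoff_sum shift f (n m) x - main m x) \<le> 2 / real m * l2_norm M (main m)"
proof -
  have 1: "1 \<le> sqrt (2 * real (n m))" using n_pos[of m] by simp
  have "l2_norm M (\<lambda>x. birkhoff_sum shift f (n m) x - main m x)
      \<le> (\<Sum>k<m. total k * sqrt (real (n m + N k))) + real (n m) * (\<Sum>k. e (k + Suc m))"
    by (rule l2_norm_rest(2))
  also have "\<dots> \<le> (\<Sum>k<m. total k * sqrt (2 * real (n m))) + 1"
  proof (intro add_mono sum_mono mult_left_mono tail total_nonneg)
    fix k assume "k \<in> {..<m}"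
    then have "n k < n m" using n_strict_mono by (auto simp: strict_mono_def)
    then show "sqrt (real (n m + N k)) \<le> sqrt (2 * real (n m))"
      using N_le[of k] by simp
  qed
  also have "(\<Sum>k<m. total k * sqrt (2 * real (n m))) = (fact m - 1) * sqrt (2 * real (n m))"
    unfolding total_eq sum_distrib_right[symmetric] sum_mult_fact ..
  \<comment> \<open>The 1 left by the later components fits into the gap between m! - 1 and m!,
    because sqrt (2 * n m) \<ge> 1.\<close>
  also have "(fact m - 1) * sqrt (2 * real (n m)) + 1 \<le> fact m * sqrt (2 * real (n m))"
    using 1 by (simp add: left_diff_distrib)
  also have "\<dots> = 2 / real m * (real m * fact m * sqrt (real (n m) / 2))"
  proof -
    have "sqrt (2 * real (n m)) = sqrt (4 * (real (n m) / 2))" by simp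
    also have "\<dots> = 2 * sqrt (real (n m) / 2)" by (simp only: real_sqrt_mult real_sqrt_four)
    finally show ?thesis using assms by simp
  qed
  also have "\<dots> \<le> 2 / real m * l2_norm M (main m)"
    by (intro mult_left_mono main_lower) simp
  finally show ?thesis .
qed

definition normalized :: "nat \<Rightarrow> (int \<Rightarrow> nat \<Rightarrow> real) \<Rightarrow> real" where
  "normalized m x = birkhoff_sum shift f (n m) x / l2_norm M (birkhoff_sum shift f (n m))"

text \<open>For c = 2/m the bound 2c / (1 - c) is 4 / (m - 2), and m = 3 is the first index with c <
  1; hence the starting indices 3 and 4 of the two subsequences.\<close>

lemma
  assumes m: "m \<ge> 3"
  shows l2_norm_birkhoff_f_pos: "0 < l2_norm M (birkhoff_sum shift f (n m))"
    and normalized_close: "\<delta> > 0 \<Longrightarrow>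
      prob {x \<in> space M. \<bar>normalized m x - main m x / l2_norm M (main m)\<bar> > \<delta>} \<le> 4 / (real m - 2) / \<delta>"
proof -
  have c: "2 / real m < 1" using m by simp
  have m1: "m \<ge> 1" using m by simp
  note close = square_integrable_birkhoff_f[of "n m"] square_integrable_birkhoff_component[of m "n m"]
    c main_pos[OF m1] rest_le[OF m1]
  show "0 < l2_norm M (birkhoff_sum shift f (n m))"
    by (rule l2_norm_pos_of_close[OF close])
  assume "\<delta> > 0"
  have "prob {x \<in> space M. \<bar>normalized m x - main m x / l2_norm M (main m)\<bar> > \<delta>}
      \<le> l2_norm M (\<lambda>x. normalized m x - main m x / l2_norm M (main m)) / \<delta>"
    unfolding normalized_def
    by (rule l2_norm_Markov[OF square_integrable_normalized_diff[OF close] \<open>\<delta> > 0\<close>])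
  also have "\<dots> \<le> 2 * (2 / real m) / (1 - 2 / real m) / \<delta>"
    unfolding normalized_def using \<open>\<delta> > 0\<close>
    by (intro divide_right_mono l2_norm_normalized_diff[OF close]) simp
  also have "2 * (2 / real m) / (1 - 2 / real m) = 4 / (real m - 2)"
    using m by (simp add: field_simps)
  finally show "prob {x \<in> space M. \<bar>normalized m x - main m x / l2_norm M (main m)\<bar> > \<delta>}
      \<le> 4 / (real m - 2) / \<delta>" .
qed

lemma normalized_measurable: "normalized m \<in> borel_measurable M"
  unfolding normalized_def[abs_def] by (intro borel_measurable_divide birkhoff_f_measurable) simp

lemma main_measurable: "main m \<in> borel_measurable M"
  using square_integrable_birkhoff_component[of m "n m"] by (simp add: square_integrable_def)

lemma distr_main_normal:
  assumes "even m" "m \<ge> 1"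
  shows "distr M borel (\<lambda>x. main m x / l2_norm M (main m)) = std_normal_distribution"
proof -
  have eq: "main m = (\<lambda>x. \<Sum>s\<in>{- int (N m)..<int (n m)}. coef m (n m) s * x s m)"
    by (simp add: birkhoff_component fun_eq_iff)
  have "0 < (l2_norm M (main m))\<^sup>2" using main_pos[OF assms(2)] by simp
  then have "0 < (\<Sum>s\<in>{- int (N m)..<int (n m)}. (coef m (n m) s)\<^sup>2)"
    by (simp only: l2_norm_birkhoff_component)
  then show ?thesis
    unfolding eq by (intro distr_linear_normal normal_innovation assms(1) coef_nonneg) simp_all
qed

lemma prob_main_nonzero_le:
  assumes "odd m"
  shows "prob {x \<in> space M. main m x \<noteq> 0} \<le> 1 / real m"
proof -
  have "prob {x \<in> space M. main m x \<noteq> 0}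
      \<le> real (card {- int (N m)..<int (n m)}) * measure (\<nu> m) {y. y \<noteq> 0}"
    unfolding birkhoff_component by (rule prob_linear_nonzero_le) simp
  also have "\<dots> \<le> real (2 * n m) * measure (\<nu> m) {y. y \<noteq> 0}"
    using N_le[of m] by (intro mult_right_mono) auto
  also have "\<dots> \<le> 1 / real m" by (rule rare_innovation[OF assms])
  finally show ?thesis .
qed

text \<open>At even indices the normalised main term is exactly standard normal, so closeness in
  probability is all that remains.\<close>

lemma converge_normal:
  "normalized_sums_converge M shift f (\<lambda>k. n (2 * k + 4)) std_normal_distribution"
  unfolding normalized_sums_converge_def
proof (intro conjI allI)
  show "0 < l2_norm M (birkhoff_sum shift f (n (2 * k + 4)))" for k
    by (rule l2_norm_birkhoff_f_pos) simp
  have "weak_conv_m (\<lambda>k. distr M borel (normalized (2 * k + 4))) std_normal_distribution"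
  proof (rule weak_conv_m_of_close_in_prob)
    show "distr M borel (\<lambda>x. main (2 * k + 4) x / l2_norm M (main (2 * k + 4))) = std_normal_distribution" for k
      by (rule distr_main_normal) simp_all
    show "(\<lambda>x. main (2 * k + 4) x / l2_norm M (main (2 * k + 4))) \<in> borel_measurable M" for k
      by (intro borel_measurable_divide main_measurable) simp
    fix \<delta> :: real assume \<delta>: "\<delta> > 0"
    show "(\<lambda>k. prob {x \<in> space M. \<bar>normalized (2 * k + 4) x
        - main (2 * k + 4) x / l2_norm M (main (2 * k + 4))\<bar> > \<delta>}) \<longlonglongrightarrow> 0"
    proof (rule tendsto_sandwich[OF always_eventually always_eventually tendsto_const])
      show "\<forall>k. prob {x \<in> space M. \<bar>normalized (2 * k + 4) x
        - main (2 * k + 4) x / l2_norm M (main (2 * k + 4))\<bar> > \<delta>} \<le> 4 / (real (2 * k + 4) - 2) / \<delta>"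
        by (intro allI normalized_close \<delta>) simp
      show "(\<lambda>k. 4 / (real (2 * k + 4) - 2) / \<delta>) \<longlonglongrightarrow> 0"
        by (rule tendsto_divide_zero) real_asymp
    qed simp
  qed (rule normalized_measurable)
  then show "weak_conv_m (\<lambda>k. distr M borel (\<lambda>x. birkhoff_sum shift f (n (2 * k + 4)) x /
      l2_norm M (birkhoff_sum shift f (n (2 * k + 4))))) std_normal_distribution"
    by (simp only: normalized_def[abs_def])
qed

text \<open>At odd indices the normalised main term has norm 1 but is nonzero only with probability
  at most 1/m: it vanishes in probability while its second moment does not. The comparison variable
  can therefore be 0 itself.\<close>

lemma converge_zero:
  "normalized_sums_converge M shift f (\<lambda>k. n (2 * k + 3)) (return borel 0)"
  unfolding normalized_sums_converge_def
proof (intro conjI allI)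
  show "0 < l2_norm M (birkhoff_sum shift f (n (2 * k + 3)))" for k
    by (rule l2_norm_birkhoff_f_pos) simp
  have "weak_conv_m (\<lambda>k. distr M borel (normalized (2 * k + 3))) (return borel 0)"
  proof (rule weak_conv_m_of_close_in_prob[where W = "\<lambda>_ _. 0"])
    show "distr M borel (\<lambda>_. 0) = return borel (0::real)"
      by (rule distr_const) simp
    fix \<delta> :: real assume \<delta>: "\<delta> > 0"
    have bound: "prob {x \<in> space M. \<bar>normalized m x - 0\<bar> > \<delta>} \<le> 4 / (real m - 2) / \<delta> + 1 / real m"
      if m: "m \<ge> 3" "odd m" for m
    proof -
      let ?A = "{x \<in> space M. \<bar>normalized m x - main m x / l2_norm M (main m)\<bar> > \<delta>}"
      let ?B = "{x \<in> space M. main m x \<noteq> 0}"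
      have [measurable]: "normalized m \<in> borel_measurable M" "main m \<in> borel_measurable M"
        by (rule normalized_measurable main_measurable)+
      have "prob {x \<in> space M. \<bar>normalized m x - 0\<bar> > \<delta>} \<le> prob (?A \<union> ?B)"
        by (intro finite_measure_mono) auto
      also have "\<dots> \<le> prob ?A + prob ?B" by (intro measure_Un_le) auto
      also have "\<dots> \<le> 4 / (real m - 2) / \<delta> + 1 / real m"
        by (intro add_mono normalized_close prob_main_nonzero_le m \<delta>)
      finally show ?thesis .
    qed
    show "(\<lambda>k. prob {x \<in> space M. \<bar>normalized (2 * k + 3) x - 0\<bar> > \<delta>}) \<longlonglongrightarrow> 0"
    proof (rule tendsto_sandwich[OF always_eventually always_eventually tendsto_const])
      show "\<forall>k. prob {x \<in> space M. \<bar>normalized (2 * k + 3) x - 0\<bar> > \<delta>}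
          \<le> 4 / (real (2 * k + 3) - 2) / \<delta> + 1 / real (2 * k + 3)"
        by (intro allI bound) simp_all
      show "(\<lambda>k. 4 / (real (2 * k + 3) - 2) / \<delta> + 1 / real (2 * k + 3)) \<longlonglongrightarrow> 0"
        by (intro tendsto_add_zero tendsto_divide_zero) real_asymp+
    qed simp
  qed (simp_all add: normalized_measurable)
  then show "weak_conv_m (\<lambda>k. distr M borel (\<lambda>x. birkhoff_sum shift f (n (2 * k + 3)) x /
      l2_norm M (birkhoff_sum shift f (n (2 * k + 3))))) (return borel 0)"
    by (simp only: normalized_def[abs_def])
qed

text \<open>Second moments separate the limits, 1 against 0; index 0 is even, so
  \<open>\<nu> 0\<close> supplies the moment of the normal law.\<close>

lemma normal_ne_zero: "std_normal_distribution \<noteq> return borel 0"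
proof
  assume "std_normal_distribution = return borel 0"
  then have "(\<integral>y. y\<^sup>2 \<partial>\<nu> 0) = (\<integral>y. y\<^sup>2 \<partial>return borel (0::real))"
    by (simp only: normal_innovation[OF even_zero])
  then show False by (simp add: innovation_variance integral_return)
qed

end

text \<open>A recursive choice in the order e, then a and N, then n. The next e is taken below
  2^(-m-1) / n m, so that later components are invisible at time n m however large their totals
  become. \<open>P\<close> collects the conditions on one stage, \<open>Q\<close> those between
  consecutive stages.\<close>

lemma dominating_scales_exist:
  obtains a :: "nat \<Rightarrow> nat \<Rightarrow> real" and N :: "nat \<Rightarrow> nat" and e :: "nat \<Rightarrow> real" and n :: "nat \<Rightarrow> nat"
  where "\<And>m i. 0 \<le> a m i" "\<And>m i. N m \<le> i \<Longrightarrow> a m i = 0"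
    "\<And>m k K. 1 \<le> k \<Longrightarrow> (\<Sum>i<K. (\<Sum>l=i..<i+k. a m l)\<^sup>2) \<le> (e m)\<^sup>2 * real k / (1 + ln (real k))\<^sup>2"
    "\<And>m. 0 \<le> e m" "summable e" "\<And>m. (\<Sum>i<N m. a m i) = real m * fact m"
    "strict_mono n" "\<And>m. 1 \<le> n m" "\<And>m. 2 * N m \<le> n m"
    "\<And>m. real (n m) * (\<Sum>k. e (k + Suc m)) \<le> 1"
proof -
  define P :: "nat \<Rightarrow> (nat \<Rightarrow> real) \<times> nat \<times> real \<times> nat \<Rightarrow> bool" where
    "P m = (\<lambda>(a, N, e, n). (\<forall>i. 0 \<le> a i) \<and> (\<forall>i\<ge>N. a i = 0) \<and>
      (\<forall>k\<ge>1. \<forall>K. (\<Sum>i<K. (\<Sum>l=i..<i+k. a l)\<^sup>2) \<le> e\<^sup>2 * real k / (1 + ln (real k))\<^sup>2) \<and>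
      0 \<le> e \<and> e \<le> (1 / 2) ^ m \<and> (\<Sum>i<N. a i) = real m * fact m \<and> 1 \<le> n \<and> 2 * N \<le> n)" for m
  define Q :: "nat \<Rightarrow> (nat \<Rightarrow> real) \<times> nat \<times> real \<times> nat \<Rightarrow> (nat \<Rightarrow> real) \<times> nat \<times> real \<times> nat \<Rightarrow> bool" where
    "Q m = (\<lambda>(a, N, e, n) (a', N', e', n'). n < n' \<and> e' \<le> (1 / 2) ^ Suc m / real n)" for m
  have step: "\<exists>a N e n. P m (a, N, e, n) \<and> n > n0 \<and> e \<le> b" if "b > 0" for m n0 b
  proof -
    define \<epsilon> where "\<epsilon> = min b ((1 / 2) ^ m)"
    have \<epsilon>: "0 < \<epsilon>" "\<epsilon> \<le> b" "\<epsilon> \<le> (1 / 2) ^ m" using that by (auto simp: \<epsilon>_def)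
    obtain a N where "\<forall>i. 0 \<le> a i" "\<forall>i\<ge>N. a i = 0" "(\<Sum>i<N. a i) = real m * fact m"
      "\<forall>k\<ge>1. \<forall>K. (\<Sum>i<K. (\<Sum>l=i..<i+k. a l)\<^sup>2) \<le> \<epsilon>\<^sup>2 * real k / (1 + ln (real k))\<^sup>2"
      using ex_slow_coefficients[of "real m * fact m" \<epsilon>] \<epsilon> by auto
    \<comment> \<open>This n exceeds n0 and is at least 2 * N, whatever cut-off the coefficients
      have forced.\<close>
    then have "P m (a, N, \<epsilon>, 2 * N + n0 + 1)" using \<epsilon> by (simp add: P_def)
    then show ?thesis using \<epsilon> by (intro exI[of _ a] exI[of _ N] exI[of _ \<epsilon>] exI[of _ "2 * N + n0 + 1"]) simp
  qed
  have "\<exists>s. \<forall>m. P m (s m) \<and> Q m (s m) (s (Suc m))"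
  proof (rule dependent_nat_choice)
    show "\<exists>s. P 0 s" using step[of 1 0 0] by auto
    fix s m assume "P m s"
    obtain a N e n where s: "s = (a, N, e, n)" by (cases s)
    have "0 < (1 / 2) ^ Suc m / real n" using \<open>P m s\<close> by (simp add: s P_def)
    from step[OF this, of "Suc m" n] show "\<exists>s'. P (Suc m) s' \<and> Q m s s'"
      by (force simp: s Q_def)
  qed
  then obtain s where s: "\<And>m. P m (s m)" "\<And>m. Q m (s m) (s (Suc m))" by blast
  define a where "a m = fst (s m)" for m
  define N where "N m = fst (snd (s m))" for m
  define e where "e m = fst (snd (snd (s m)))" for m
  define n where "n m = snd (snd (snd (s m)))" for m
  have sm: "s m = (a m, N m, e m, n m)" for m by (simp add: a_def N_def e_def n_def)
  have P: "P m (a m, N m, e m, n m)" and Q: "Q m (a m, N m, e m, n m) (a (Suc m), N (Suc m), e (Suc m), n (Suc m))" for m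
    using s by (simp_all only: sm)
  have mono: "strict_mono n" using Q by (intro strict_monoI_Suc) (simp add: Q_def)
  have e: "0 \<le> e m" "e m \<le> (1 / 2) ^ m" "1 \<le> n m" for m using P[of m] by (auto simp: P_def)
  have e_summable: "summable e"
    by (rule summable_comparison_test'[OF summable_geometric[of "1 / 2 :: real"], where N = 0]) (use e in auto)
  have tail: "real (n m) * (\<Sum>k. e (k + Suc m)) \<le> 1" for m
  proof -
    \<comment> \<open>\<open>Q\<close> at stage k + m refers to n (k + m); monotonicity replaces
      this by n m, and the remaining powers of 1/2 sum to 1.\<close>
    have le: "e (k + Suc m) \<le> 1 / real (n m) * (1 / 2) ^ Suc k" for k
    proof -
      have "e (k + Suc m) \<le> (1 / 2) ^ Suc (k + m) / real (n (k + m))"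
        using Q[of "k + m"] by (simp add: Q_def)
      also have "\<dots> \<le> (1 / 2) ^ Suc k / real (n m)"
      proof (rule frac_le)
        show "(1 / 2) ^ Suc (k + m) \<le> (1 / 2 :: real) ^ Suc k" by (rule power_decreasing) auto
        show "real (n m) \<le> real (n (k + m))" using mono by (simp add: strict_mono_less_eq)
      qed (use e(3)[of m] in auto)
      finally show ?thesis by simp
    qed
    have "(\<lambda>k. 1 / real (n m) * (1 / 2) ^ Suc k) sums (1 / real (n m) * 1)"
      by (rule sums_mult[OF power_half_series])
    then have "(\<Sum>k. e (k + Suc m)) \<le> 1 / real (n m)"
      using suminf_le[OF le summable_ignore_initial_segment[OF e_summable]] by (simp add: sums_iff)
    then show ?thesis using e(3)[of m] by (simp add: field_simps)
  qed
  show ?thesis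
    by (rule that[of a N e n]) (use P mono e_summable tail in \<open>simp_all add: P_def\<close>)
qed

theorem theorem3:
  shows "\<exists>(M :: path measure) (T :: path \<Rightarrow> path) (F :: int \<Rightarrow> path measure) (f :: path \<Rightarrow> real).
    ergodic_dynamical_system M T \<and>
    (\<forall>i j. i \<le> j \<longrightarrow> sets (F i) \<subseteq> sets (F j)) \<and>
    (\<forall>i. subalgebra M (F i)) \<and>
    (\<forall>i. (\<lambda>A. T -` A \<inter> space M) ` sets (F i) = sets (F (i + 1))) \<and>
    f \<in> borel_measurable (F 0) \<and>
    integrable M (\<lambda>x. (f x)\<^sup>2) \<and>
    (\<integral>x. f x \<partial>M) = 0 \<and>
    (\<lambda>n::nat. l2_norm M (real_cond_exp M (F 0) (birkhoff_sum T f n)))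
      \<in> o(\<lambda>n. sqrt (real n) / ln (real n)) \<and>
    (\<exists>(n' :: nat \<Rightarrow> nat) (n'' :: nat \<Rightarrow> nat) \<nu>' \<nu>''.
      strict_mono n' \<and> strict_mono n'' \<and>
      (\<forall>k. n' k > 0) \<and> (\<forall>k. n'' k > 0) \<and>
      real_distribution \<nu>' \<and> real_distribution \<nu>'' \<and>
      normalized_sums_converge M T f n' \<nu>' \<and>
      normalized_sums_converge M T f n'' \<nu>'' \<and>
      \<nu>' \<noteq> \<nu>'')"
proof -
  obtain a :: "nat \<Rightarrow> nat \<Rightarrow> real" and N e n where
    coeff: "\<And>m i. 0 \<le> a m i" "\<And>m i. N m \<le> i \<Longrightarrow> a m i = 0"
      "\<And>m k K. 1 \<le> k \<Longrightarrow> (\<Sum>i<K. (\<Sum>l=i..<i+k. a m l)\<^sup>2) \<le> (e m)\<^sup>2 * real k / (1 + ln (real k))\<^sup>2"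
      "\<And>m. 0 \<le> e m" "summable e" "\<And>m. (\<Sum>i<N m. a m i) = real m * fact m"
    and scales: "strict_mono n" "\<And>m. 1 \<le> n m" "\<And>m. 2 * N m \<le> n m"
      "\<And>m. real (n m) * (\<Sum>k. e (k + Suc m)) \<le> 1"
    by (rule dominating_scales_exist) blast
  \<comment> \<open>The rarity of an innovation depends on the scale, so the laws come after n: at
    most 2 * n m innovations, each nonzero with probability at most p m, leave 1/m in all.\<close>
  define p where "p m = 1 / (real m * real (2 * n m))" for m
  define good where "good m \<mu> \<longleftrightarrow> prob_space \<mu> \<and> sets \<mu> = sets borel \<and> integrable \<mu> (\<lambda>y. y\<^sup>2) \<and>
      (\<integral>y. y \<partial>\<mu>) = 0 \<and> (\<integral>y. y\<^sup>2 \<partial>\<mu>) = (1::real) \<and>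
      (even m \<longrightarrow> \<mu> = std_normal_distribution) \<and> (odd m \<longrightarrow> measure \<mu> {y. y \<noteq> 0} \<le> p m)" for m \<mu>
  have "\<exists>\<mu>. good m \<mu>" for m
  proof (cases "even m")
    case True
    interpret std: real_distribution std_normal_distribution by (rule real_dist_normal_dist)
    have "integrable std_normal_distribution (\<lambda>y. y\<^sup>2)" "(\<integral>y. y\<^sup>2 \<partial>std_normal_distribution) = 1"
      using std_normal_distribution_even_moments[of 1] by (simp_all add: numeral_2_eq_2)
    moreover have "(\<integral>y. y \<partial>std_normal_distribution) = 0"
      using integral_std_normal_distribution_moment_odd[of 1] by simp
    ultimately have "good m std_normal_distribution"
      using True std.prob_space_axioms by (simp add: good_def)
    then show ?thesis by blast
  next
    case False
    \<comment> \<open>An odd m is nonzero, so this quotient is not the value 0 of a division by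
      zero.\<close>
    then have "0 < p m" using scales(2)[of m] by (cases m) (auto simp: p_def)
    from ex_rare_innovation[OF this] False show ?thesis by (simp add: good_def)
  qed
  then obtain \<nu> where "\<And>m. good m (\<nu> m)" by metis
  then have \<nu>: "\<And>m. prob_space (\<nu> m)" "\<And>m. sets (\<nu> m) = sets borel"
    "\<And>m. integrable (\<nu> m) (\<lambda>y. y\<^sup>2)" "\<And>m. (\<integral>y. y \<partial>\<nu> m) = 0" "\<And>m. (\<integral>y. y\<^sup>2 \<partial>\<nu> m) = (1::real)"
    "\<And>m. even m \<Longrightarrow> \<nu> m = std_normal_distribution" "\<And>m. odd m \<Longrightarrow> measure (\<nu> m) {y. y \<noteq> 0} \<le> p m"
    unfolding good_def by blast+
  have rare: "real (2 * n m) * measure (\<nu> m) {y. y \<noteq> 0} \<le> 1 / real m" if "odd m" for m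
  proof -
    have "real (2 * n m) * measure (\<nu> m) {y. y \<noteq> 0} \<le> real (2 * n m) * p m"
      using \<nu>(7)[OF that] by (intro mult_left_mono) auto
    also have "\<dots> = 1 / real m" using scales(2)[of m] by (simp add: p_def)
    finally show ?thesis .
  qed
  interpret dominating_scales \<nu> a N e n
    by (intro dominating_scales.intro dominating_scales_axioms.intro moving_average.intro
        moving_average_axioms.intro innovation_family.intro) (fact \<nu> coeff scales rare)+
  show ?thesis
  proof (rule exI[of _ M], rule exI[of _ shift], rule exI[of _ "past (Pi\<^sub>M UNIV \<nu>)"], rule exI[of _ f],
      intro conjI allI impI)
    show "ergodic_dynamical_system M shift" by (rule ergodic_shift)
    show "sets (past (Pi\<^sub>M UNIV \<nu>) i) \<subseteq> sets (past (Pi\<^sub>M UNIV \<nu>) j)" if "i \<le> j" for i j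
      by (rule sets_past_mono[OF that])
    show "subalgebra M (past (Pi\<^sub>M UNIV \<nu>) i)" for i by (rule subalgebra_past)
    show "(\<lambda>A. shift -` A \<inter> space M) ` sets (past (Pi\<^sub>M UNIV \<nu>) i) = sets (past (Pi\<^sub>M UNIV \<nu>) (i + 1))" for i
      by (rule shift_vimage_past)
    show "f \<in> borel_measurable past0" by (rule f_measurable_past)
    show "integrable M (\<lambda>x. (f x)\<^sup>2)" using square_integrable_f by (simp add: square_integrable_def)
    show "expectation f = 0" by (rule expectation_f)
    show "(\<lambda>n. l2_norm M (real_cond_exp M past0 (birkhoff_sum shift f n))) \<in> o(\<lambda>n. sqrt (real n) / ln (real n))"
      by (rule cond_exp_smallo)
    have "strict_mono (\<lambda>k. n (2 * k + c))" for c
      using n_strict_mono by (simp add: strict_mono_def)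
    moreover have "0 < n m" for m using n_pos[of m] by simp
    moreover have "real_distribution (return borel 0)"
      by (intro real_distribution.intro real_distribution_axioms.intro prob_space_return) simp_all
    ultimately show "\<exists>n' n'' \<nu>' \<nu>''. strict_mono n' \<and> strict_mono n'' \<and>
        (\<forall>k. n' k > 0) \<and> (\<forall>k. n'' k > 0) \<and>
        real_distribution \<nu>' \<and> real_distribution \<nu>'' \<and>
        normalized_sums_converge M shift f n' \<nu>' \<and>
        normalized_sums_converge M shift f n'' \<nu>'' \<and> \<nu>' \<noteq> \<nu>''"
      using converge_normal converge_zero real_dist_normal_dist normal_ne_zero by blast
  qed
qed

end
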